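(* Let $[0,T]$ be a fixed and bounded time interval, let $\Omega\subset\mathbb{R}^2$ be bounded, let $I(t),\sigma_t,\Theta(t),\eta_t,\rho_t$ be as described in the context, and let $$L:=\sup_{(\theta,s)\in Z^2}\int_{\{x\cdot\theta=s\}\cap\Omega}dx<\infty .$$ Then for $p\in[1,\infty)$ the time-dependent Radon transform $$\mathcal{A}:L^p(\Omega\times[0,T])\to L^p\Big(\bigcup_{t\in[0,T]}I(t)\times\{t\}\Big),\qquad(\mathcal{A}u)(\theta,s,t)=(\mathcal{R}_{I(t)}u(\cdot,t))(\theta,s)=\int_{x\cdot\theta=s}u(x,t)\,dx,$$ is a well-defined bounded linear operator with dual operator $$(\mathcal{A}^*\varphi)(x,t)=(\mathcal{R}_{I(t)}^*\varphi(\cdot,t))(x).$$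
   Context: $T>0$ is fixed, $\Omega\subset\mathbb{R}^2$ is a bounded domain containing the support of the functions considered, $S^1$ is the unit circle in $\mathbb{R}^2$, and $Z^2=\{(\theta,s):\theta\in S^1,\ s\in\mathbb{R}\}$ is the infinite unit cylinder. Integrals over $\{x\cdot\theta=s\}$ are line integrals (over the part of the line in $\Omega$). For each $t\in[0,T]$, $I(t)\subset Z^2$ is the set of active measurement parameters at time $t$, equipped with a nonnegative Radon measure $\sigma_t$ (possibly partially discrete with respect to $\theta$); $L^p_{\sigma_t}(I(t))$ is the corresponding $L^p$ space. $\Theta(t)$ is the set of all $\theta$ appearing in $I(t)$, and $$\Omega(t)=\{x\in\Omega:\ \exists(\theta,s)\in I(t)\text{ with }s=x\cdot\theta\}.$$ Standing assumption: there exist a nonnegative Radon measure $\eta_t$ on $\Theta(t)$ and a bounded (uniformly in time) measurable function $\rho_t$ supported on $\Omega(t)$ such that $$\int_{I(t)}\int_{\{x\cdot\theta=s\}\cap\Omega}\psi(x,s,\theta)\,dx\,d\sigma_t=\int_{\Theta(t)}\int_\Omega\psi(x,\theta\cdot x,\theta)\,\rho_t(x)\,dx\,d\eta_t$$ for all integrable functions $\psi$. The operator $\mathcal{R}_{I(t)}:L^p(\Omega)\to L^p_{\sigma_t}(I(t))$ is given by $(\mathcal{R}_{I(t)}v)(\theta,s)=\int_{x\cdot\theta=s}v(x)\,dx$ for $(\theta,s)\in I(t)$. Its dual operator $\mathcal{R}_{I(t)}^*:L^{p_*}_{\sigma_t}(I(t))\to L^{p_*}(\Omega)$, with $p_*$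 the conjugate exponent of $p$, is $$(\mathcal{R}_{I(t)}^*\phi)(x)=\rho_t(x)\int_{\Theta(t)}\phi(\theta,x\cdot\theta)\,d\eta_t .$$ The space $L^p(\bigcup_{t\in[0,T]}I(t)\times\{t\})$ is understood with respect to $\sigma_t$ in $(\theta,s)\in I(t)$ and Lebesgue measure in $t\in[0,T]$.
   Formalization: The total mass of η_t on Θ(t) is also assumed bounded uniformly in t; without this A can be unbounded (I(t)=Z², σ_t=t^{-1/2}dθ ds, η_t=t^{-1/2}dθ, ρ_t=1). Measurable dependence of I(t), σ_t, η_t, ρ_t on t is made explicit. *)

theory Defs
  imports "HOL-Analysis.Analysis" "HOL-Probability.Essential_Supremum"
begin

text \<open>
  \<open>L\<^sup>p\<close> spaces, \<open>p \<in> [1,\<infinity>]\<close>, are represented by their measurable functions; identification of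
  functions that agree almost everywhere is made explicit in \<open>Lp_operator\<close>.
\<close>

definition Lp :: "ennreal \<Rightarrow> 'a measure \<Rightarrow> ('a \<Rightarrow> real) set" where
  "Lp p M = {f \<in> borel_measurable M.
     if p = \<infinity> then esssup M (\<lambda>x. ereal \<bar>f x\<bar>) < \<infinity>
     else integrable M (\<lambda>x. \<bar>f x\<bar> powr enn2real p)}"

definition Lp_norm :: "ennreal \<Rightarrow> 'a measure \<Rightarrow> ('a \<Rightarrow> real) \<Rightarrow> real" where
  "Lp_norm p M f =
     (if p = \<infinity> then real_of_ereal (esssup M (\<lambda>x. ereal \<bar>f x\<bar>))
      else (\<integral>x. \<bar>f x\<bar> powr enn2real p \<partial>M) powr (1 / enn2real p))"

definition conjugate_exponents :: "ennreal \<Rightarrow> ennreal \<Rightarrow> bool" where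
  "conjugate_exponents p q \<longleftrightarrow> 1 \<le> p \<and> 1 \<le> q \<and> inverse p + inverse q = 1"

text \<open>\<open>F\<close> induces a well-defined bounded linear operator \<open>L\<^sup>p(M) \<rightarrow> L\<^sup>p(N)\<close> of equivalence classes.\<close>

definition Lp_operator ::
    "ennreal \<Rightarrow> 'a measure \<Rightarrow> 'b measure \<Rightarrow> (('a \<Rightarrow> real) \<Rightarrow> 'b \<Rightarrow> real) \<Rightarrow> bool" where
  "Lp_operator p M N F \<longleftrightarrow>
     (\<forall>f\<in>Lp p M. F f \<in> Lp p N) \<and>
     (\<forall>f\<in>Lp p M. \<forall>g\<in>Lp p M. (AE x in M. f x = g x) \<longrightarrow> (AE y in N. F f y = F g y)) \<and>
     (\<forall>f\<in>Lp p M. \<forall>g\<in>Lp p M. \<forall>a b.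
        AE y in N. F (\<lambda>x. a * f x + b * g x) y = a * F f y + b * F g y) \<and>
     (\<exists>C. \<forall>f\<in>Lp p M. Lp_norm p N (F f) \<le> C * Lp_norm p M f)"

text \<open>
  The dual of \<open>F : L\<^sup>p(M) \<rightarrow> L\<^sup>p(N)\<close>, as an operator \<open>L\<^sup>q(N) \<rightarrow> L\<^sup>q(M)\<close>, where \<open>1/p + 1/q = 1\<close> and
  \<open>L\<^sup>q\<close> is identified with the dual space of \<open>L\<^sup>p\<close> through the pairing \<open>\<integral> f g\<close>.
\<close>

definition Lp_dual_operator ::
    "ennreal \<Rightarrow> ennreal \<Rightarrow> 'a measure \<Rightarrow> 'b measure \<Rightarrow>
     (('a \<Rightarrow> real) \<Rightarrow> 'b \<Rightarrow> real) \<Rightarrow> (('b \<Rightarrow> real) \<Rightarrow> 'a \<Rightarrow> real) \<Rightarrow> bool" where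
  "Lp_dual_operator p q M N F G \<longleftrightarrow>
     conjugate_exponents p q \<and> Lp_operator q N M G \<and>
     (\<forall>f\<in>Lp p M. \<forall>g\<in>Lp q N. (\<integral>y. F f y * g y \<partial>N) = (\<integral>x. f x * G g x \<partial>M))"

definition radon_measure_on :: "'a::topological_space set \<Rightarrow> 'a measure \<Rightarrow> bool" where
  "radon_measure_on X M \<longleftrightarrow>
     space M = X \<and> sets M = sets (restrict_space borel X) \<and>
     (\<forall>x\<in>X. \<exists>U. open U \<and> x \<in> U \<and> emeasure M (U \<inter> X) < \<infinity>) \<and>
     (\<forall>A\<in>sets M. emeasure M A = (SUP K\<in>{K. compact K \<and> K \<subseteq> A \<and> K \<in> sets M}. emeasure M K))"

text \<open>Measurable dependence on time of measures \<open>M t\<close> living on sets \<open>X t\<close>, \<open>t \<in> [0,T]\<close>.\<close>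

definition measurable_measure_family ::
    "real \<Rightarrow> (real \<Rightarrow> 'a::topological_space set) \<Rightarrow> (real \<Rightarrow> 'a measure) \<Rightarrow> bool" where
  "measurable_measure_family T X M \<longleftrightarrow>
     (\<forall>B\<in>sets borel. (\<lambda>t. emeasure (M t) (B \<inter> X t)) \<in> borel_measurable (restrict_space borel {0..T}))"

definition unit_cylinder :: "((real^2) \<times> real) set" where
  "unit_cylinder = sphere 0 1 \<times> UNIV"

text \<open>
  Arc length on the line \<open>{x. x \<bullet> \<theta> = s}\<close>, for \<open>norm \<theta> = 1\<close>: the line is parametrised
  isometrically by \<open>r \<mapsto> s \<theta> + r \<theta>\<^sup>\<bottom>\<close>, with \<open>\<theta>\<^sup>\<bottom>\<close> the rotation of \<open>\<theta>\<close> by a right angle.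
\<close>

definition line_measure :: "real^2 \<Rightarrow> real \<Rightarrow> (real^2) measure" where
  "line_measure \<theta> s = distr lborel borel (\<lambda>r. s *\<^sub>R \<theta> + r *\<^sub>R vector [- (\<theta> $ 2), \<theta> $ 1])"

definition max_chord :: "(real^2) set \<Rightarrow> ennreal" where
  "max_chord \<Omega> = (SUP (\<theta>, s)\<in>unit_cylinder. emeasure (line_measure \<theta> s) \<Omega>)"

text \<open>For \<open>J = I(t)\<close> these are the sets \<open>\<Theta>(t)\<close> and \<open>\<Omega>(t)\<close>.\<close>

definition directions :: "((real^2) \<times> real) set \<Rightarrow> (real^2) set" where
  "directions J = fst ` J"

definition seen_region :: "(real^2) set \<Rightarrow> ((real^2) \<times> real) set \<Rightarrow> (real^2) set" where
  "seen_region \<Omega> J = {x \<in> \<Omega>. \<exists>(\<theta>, s)\<in>J. s = x \<bullet> \<theta>}"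

text \<open>
  The change of variables relating \<open>\<sigma>\<close> on \<open>I(t)\<close> to \<open>\<eta>\<close> on \<open>\<Theta>(t)\<close>; the test functions \<open>\<psi>\<close> are
  those for which both sides converge absolutely.
\<close>

definition change_of_variables ::
    "(real^2) set \<Rightarrow> ((real^2) \<times> real) measure \<Rightarrow> (real^2) measure \<Rightarrow> (real^2 \<Rightarrow> real) \<Rightarrow> bool" where
  "change_of_variables \<Omega> \<sigma> \<eta> \<rho> \<longleftrightarrow>
     (\<forall>\<psi> :: real^2 \<Rightarrow> real \<Rightarrow> real^2 \<Rightarrow> real.
        (\<lambda>(x, s, \<theta>). \<psi> x s \<theta>) \<in> borel_measurable borel \<longrightarrow>
        (\<integral>\<^sup>+ (\<theta>, s). (\<integral>\<^sup>+ x\<in>\<Omega>. ennreal \<bar>\<psi> x s \<theta>\<bar> \<partial>line_measure \<theta> s) \<partial>\<sigma>) < \<infinity> \<longrightarrow>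
        (\<integral>\<^sup>+ \<theta>. (\<integral>\<^sup>+ x\<in>\<Omega>. ennreal \<bar>\<psi> x (\<theta> \<bullet> x) \<theta> * \<rho> x\<bar> \<partial>lborel) \<partial>\<eta>) < \<infinity> \<longrightarrow>
        (\<integral> (\<theta>, s). (LINT x:\<Omega>|line_measure \<theta> s. \<psi> x s \<theta>) \<partial>\<sigma>)
          = (\<integral> \<theta>. (LINT x:\<Omega>|lborel. \<psi> x (\<theta> \<bullet> x) \<theta> * \<rho> x) \<partial>\<eta>))"

definition radon_transform :: "(real^2) set \<Rightarrow> (real^2 \<Rightarrow> real) \<Rightarrow> (real^2) \<times> real \<Rightarrow> real" where
  "radon_transform \<Omega> v = (\<lambda>(\<theta>, s). LINT x:\<Omega>|line_measure \<theta> s. v x)"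

text \<open>
  Since \<open>\<phi>\<close> is only given on \<open>J = I(t)\<close>, the integrand is extended by zero to those
  \<open>\<theta> \<in> \<Theta>(t)\<close> with \<open>(\<theta>, x \<bullet> \<theta>) \<notin> I(t)\<close>. By the change of variables, for almost every \<open>x\<close> with
  \<open>\<rho> x \<noteq> 0\<close> these \<open>\<theta>\<close> form an \<open>\<eta>\<close>-null set.
\<close>

definition dual_directions :: "((real^2) \<times> real) set \<Rightarrow> real^2 \<Rightarrow> (real^2) set" where
  "dual_directions J x = {\<theta> \<in> directions J. (\<theta>, x \<bullet> \<theta>) \<in> J}"

definition radon_dual ::
    "((real^2) \<times> real) set \<Rightarrow> (real^2) measure \<Rightarrow> (real^2 \<Rightarrow> real) \<Rightarrow>
     ((real^2) \<times> real \<Rightarrow> real) \<Rightarrow> real^2 \<Rightarrow> real" where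
  "radon_dual J \<eta> \<rho> \<phi> x = \<rho> x * (LINT \<theta>:dual_directions J x|\<eta>. \<phi> (\<theta>, x \<bullet> \<theta>))"

definition spacetime_params ::
    "real \<Rightarrow> (real \<Rightarrow> ((real^2) \<times> real) set) \<Rightarrow> (((real^2) \<times> real) \<times> real) set" where
  "spacetime_params T I = (\<Union>t\<in>{0..T}. I t \<times> {t})"

text \<open>The measure \<open>\<sigma>\<^sub>t(d(\<theta>,s)) dt\<close>; \<open>measurable_measure_family T I \<sigma>\<close> makes the integrand measurable.\<close>

definition spacetime_measure ::
    "real \<Rightarrow> (real \<Rightarrow> ((real^2) \<times> real) set) \<Rightarrow> (real \<Rightarrow> ((real^2) \<times> real) measure) \<Rightarrow>
     (((real^2) \<times> real) \<times> real) measure" where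
  "spacetime_measure T I \<sigma> =
     measure_of (spacetime_params T I) (sets (restrict_space borel (spacetime_params T I)))
       (\<lambda>A. \<integral>\<^sup>+ t\<in>{0..T}. emeasure (\<sigma> t) {z. (z, t) \<in> A} \<partial>lborel)"

definition dynamic_radon ::
    "(real^2) set \<Rightarrow> ((real^2) \<times> real \<Rightarrow> real) \<Rightarrow> ((real^2) \<times> real) \<times> real \<Rightarrow> real" where
  "dynamic_radon \<Omega> u = (\<lambda>(z, t). radon_transform \<Omega> (\<lambda>x. u (x, t)) z)"

definition dynamic_radon_dual ::
    "(real \<Rightarrow> ((real^2) \<times> real) set) \<Rightarrow> (real \<Rightarrow> (real^2) measure) \<Rightarrow> (real \<Rightarrow> real^2 \<Rightarrow> real) \<Rightarrow>
     (((real^2) \<times> real) \<times> real \<Rightarrow> real) \<Rightarrow> (real^2) \<times> real \<Rightarrow> real" where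
  "dynamic_radon_dual I \<eta> \<rho> \<phi> = (\<lambda>(x, t). radon_dual (I t) (\<eta> t) (\<rho> t) (\<lambda>z. \<phi> (z, t)) x)"

end

theory Submission imports Defs "HOL-Probability.Giry_Monad" begin

text \<open>
  Both operators are integral operators against a kernel of measures. A point
  \<open>y = ((\<theta>, s), t)\<close> carries the arc length on the chord of \<open>\<Omega>\<close> along the line \<open>x \<bullet> \<theta> = s\<close>, placed
  in the time slice \<open>t\<close>; its mass is at most the diameter of a ball containing \<open>\<Omega>\<close>. A point
  \<open>(x, t)\<close> carries \<open>\<bar>\<rho>\<^sub>t x\<bar>\<close> times the image of \<open>\<eta>\<^sub>t\<close> under \<open>\<theta> \<mapsto> ((\<theta>, x \<bullet> \<theta>), t)\<close>; its mass is at
  most the product of the bounds for \<open>\<rho>\<close> and \<open>\<eta>\<close>. The change of variables, integrated in time,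
  says that the two kernels are transposes of each other
  (\<open>transpose_kernels\<close>). A pair of transposed kernels of bounded mass always
  defines bounded operators on \<open>L\<^sup>p\<close>, for every \<open>p \<in> [1,\<infinity>]\<close>, by the Schur test
  (\<open>Lp_operator_kernel\<close>), and the two operators are dual to each other by Fubini, once Young's
  inequality makes the double integral converge absolutely (\<open>Lp_dual_operator_kernel\<close>).

  Two points need more than this.

  The change of variables is an identity of signed Bochner integrals, required only of those
  \<open>\<psi>\<close> for which both sides converge absolutely, and \<open>\<rho>\<close> may change sign.
  Tested with indicators of sets that lie over a set of parameters of finite \<open>\<sigma>\<close>-measure and on which
  \<open>\<rho>\<close> has a constant sign, it shows that the part where \<open>\<rho> < 0\<close> contributes nothing to either side
  and that both sides, with \<open>\<bar>\<rho>\<bar>\<close> for \<open>\<rho>\<close>, are integrals against one and the same measure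
  (\<open>sides_agree\<close>). This gives the identity for all nonnegative Borel functions.

  The measures \<open>\<sigma>\<^sub>t\<close> may be infinite, and their dependence on \<open>t\<close> is prescribed only on sets
  \<open>B \<inter> I t\<close> with \<open>B\<close> fixed. By local finiteness, the parameter set in space-time is covered by
  countably many products \<open>{t. \<sigma>\<^sub>t U \<le> m} \<times> U\<close>, with \<open>U\<close> from a countable basis, and on each of them
  the family is a bounded kernel, for which the usual monotone class argument works
  (\<open>measurable_emeasure\<close>). Hence \<open>\<sigma>\<^sub>t dt\<close> is countably additive and integrals against it
  can be computed slice by slice (\<open>nn_integral_spacetime\<close>).
\<close>

section \<open>Integral operators given by a pair of transposed kernels\<close>

text \<open>
  A form of Jensen's inequality on a measure of mass at most \<open>c\<close>, with the factor \<open>2 powr r\<close> as the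
  price of an elementary proof: \<open>\<bar>f\<bar> \<le> s + s powr (1 - r) * \<bar>f\<bar> powr r\<close> for every \<open>s > 0\<close>, by distinguishing whether
  \<open>\<bar>f\<bar> \<le> s\<close>; the bound follows on integrating this and choosing \<open>s\<close>.
\<close>

lemma integral_powr_le:
  fixes f :: "'a \<Rightarrow> real"
  assumes mass: "emeasure \<mu> (space \<mu>) \<le> ennreal c" and c: "c > 0" and r: "r \<ge> 1"
    and f[measurable]: "f \<in> borel_measurable \<mu>" and int: "integrable \<mu> (\<lambda>x. \<bar>f x\<bar> powr r)"
  shows "integrable \<mu> f"
    and "\<bar>\<integral>x. f x \<partial>\<mu>\<bar> powr r \<le> 2 powr r * c powr (r - 1) * (\<integral>x. \<bar>f x\<bar> powr r \<partial>\<mu>)"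
proof -
  interpret finite_measure \<mu>
    by (rule finite_measureI) (use mass in \<open>auto simp: top_unique\<close>)
  have mass': "measure \<mu> (space \<mu>) \<le> c"
    using mass c by (simp add: emeasure_eq_measure)
  have pt: "\<bar>f x\<bar> \<le> s + s powr (1 - r) * \<bar>f x\<bar> powr r" if s: "s > 0" for s x
  proof (cases "\<bar>f x\<bar> \<le> s")
    case True
    then show ?thesis using s by (simp add: add_increasing2)
  next
    case False
    then have "\<bar>f x\<bar> = \<bar>f x\<bar> powr (1 - r) * \<bar>f x\<bar> powr r"
      using s by (simp flip: powr_add)
    also have "\<dots> \<le> s powr (1 - r) * \<bar>f x\<bar> powr r"
      using False s r by (intro mult_right_mono powr_mono2') auto
    finally show ?thesis using s by simp
  qed
  show I: "integrable \<mu> f"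
    by (rule Bochner_Integration.integrable_bound[of _ "\<lambda>x. 1 + 1 powr (1 - r) * \<bar>f x\<bar> powr r"])
      (use int pt[of 1] in \<open>auto intro!: Bochner_Integration.integrable_add\<close>)
  define J where "J = (\<integral>x. \<bar>f x\<bar> powr r \<partial>\<mu>)"
  have J0: "J \<ge> 0" by (simp add: J_def)
  show "\<bar>\<integral>x. f x \<partial>\<mu>\<bar> powr r \<le> 2 powr r * c powr (r - 1) * (\<integral>x. \<bar>f x\<bar> powr r \<partial>\<mu>)"
  proof (cases "J = 0")
    case True
    then have "AE x in \<mu>. \<bar>f x\<bar> powr r = 0"
      using integral_nonneg_eq_0_iff_AE[OF int] by (simp add: J_def)
    then have "AE x in \<mu>. f x = 0" by auto
    then have "(\<integral>x. f x \<partial>\<mu>) = 0" by (rule integral_eq_zero_AE)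
    then show ?thesis using True by (simp add: J_def)
  next
    case False
    with J0 have J: "J > 0" by simp
    \<comment> \<open>this \<open>s\<close> balances the two terms \<open>c * s\<close> and \<open>s powr (1 - r) * J\<close> of the integrated bound\<close>
    define s where "s = (J / c) powr (1 / r)"
    have s: "s > 0" and sr: "s powr r = J / c"
      using J c r by (auto simp: s_def powr_powr)
    have "\<bar>\<integral>x. f x \<partial>\<mu>\<bar> \<le> (\<integral>x. \<bar>f x\<bar> \<partial>\<mu>)" by (rule integral_abs_bound)
    also have "\<dots> \<le> (\<integral>x. s + s powr (1 - r) * \<bar>f x\<bar> powr r \<partial>\<mu>)"
      using int I pt[OF s] by (intro integral_mono) auto
    also have "\<dots> = measure \<mu> (space \<mu>) * s + s powr (1 - r) * J"
      using int by (simp add: J_def)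
    also have "\<dots> \<le> c * s + s powr (1 - r) * J"
      using mass' s by simp
    also have "s powr (1 - r) * J = c * (s powr (1 - r) * s powr r)"
      using c by (simp add: sr)
    also have "s powr (1 - r) * s powr r = s"
      using s by (simp flip: powr_add)
    finally have "\<bar>\<integral>x. f x \<partial>\<mu>\<bar> \<le> 2 * c * s" by simp
    then have "\<bar>\<integral>x. f x \<partial>\<mu>\<bar> powr r \<le> (2 * c * s) powr r"
      using r by (intro powr_mono2) auto
    also have "\<dots> = 2 powr r * c powr r * (J / c)"
      using c s by (simp add: powr_mult sr)
    also have "c powr r = c powr (r - 1) * c"
      using c by (simp flip: powr_add add: powr_mult_base mult.commute)
    finally show ?thesis using c by (simp add: J_def)
  qed
qed

text \<open>
  The equation \<open>transpose\<close> expresses that \<open>K\<^sub>y(dx) N(dy)\<close> and \<open>L\<^sub>x(dy) M(dx)\<close> are the same measure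
  on the product; rectangular integrands are all that operators and pairings require.
  The setting is symmetric in the two kernels, so that each fact about \<open>K\<close> is also one about \<open>L\<close>.
\<close>

locale transposed_kernels =
  fixes M :: "'a measure" and N :: "'b measure"
    and K :: "'b \<Rightarrow> 'a measure" and L :: "'a \<Rightarrow> 'b measure" and c d :: real
  assumes sets_K: "\<And>y. y \<in> space N \<Longrightarrow> sets (K y) = sets M"
    and sets_L: "\<And>x. x \<in> space M \<Longrightarrow> sets (L x) = sets N"
    and pos: "c > 0" "d > 0"
    and mass_K: "\<And>y. y \<in> space N \<Longrightarrow> emeasure (K y) (space M) \<le> ennreal c"
    and mass_L: "\<And>x. x \<in> space M \<Longrightarrow> emeasure (L x) (space N) \<le> ennreal d"
    and measurable_K: "\<And>f :: 'a \<Rightarrow> ennreal. f \<in> borel_measurable M \<Longrightarrow>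
          (\<lambda>y. \<integral>\<^sup>+ x. f x \<partial>K y) \<in> borel_measurable N"
    and measurable_L: "\<And>g :: 'b \<Rightarrow> ennreal. g \<in> borel_measurable N \<Longrightarrow>
          (\<lambda>x. \<integral>\<^sup>+ y. g y \<partial>L x) \<in> borel_measurable M"
    and transpose: "\<And>(f :: 'a \<Rightarrow> ennreal) (g :: 'b \<Rightarrow> ennreal).
          f \<in> borel_measurable M \<Longrightarrow> g \<in> borel_measurable N \<Longrightarrow>
          (\<integral>\<^sup>+ y. g y * (\<integral>\<^sup>+ x. f x \<partial>K y) \<partial>N) = (\<integral>\<^sup>+ x. f x * (\<integral>\<^sup>+ y. g y \<partial>L x) \<partial>M)"
begin

lemma swap: "transposed_kernels N M L K d c"
  by unfold_locales
    (simp_all add: sets_K sets_L pos mass_K mass_L measurable_K measurable_L transpose)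

lemma space_K: "y \<in> space N \<Longrightarrow> space (K y) = space M"
  using sets_eq_imp_space_eq[OF sets_K] .

lemma measurable_from_K: "y \<in> space N \<Longrightarrow> f \<in> measurable M R \<Longrightarrow> f \<in> measurable (K y) R"
  using measurable_cong_sets[OF sets_K refl] by blast

text \<open>
  This is where the mass of \<open>L\<close> enters: transposing turns the left-hand side into
  \<open>\<integral>\<^sup>+ x. f x * L\<^sub>x(1) \<partial>M\<close>.
\<close>

lemma nn_integral_kernel_le:
  assumes f: "f \<in> borel_measurable M"
  shows "(\<integral>\<^sup>+ y. (\<integral>\<^sup>+ x. f x \<partial>K y) \<partial>N) \<le> ennreal d * (\<integral>\<^sup>+ x. f x \<partial>M)"
proof -
  have "(\<integral>\<^sup>+ y. (\<integral>\<^sup>+ x. f x \<partial>K y) \<partial>N) = (\<integral>\<^sup>+ x. f x * (\<integral>\<^sup>+ y. 1 \<partial>L x) \<partial>M)"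
    using transpose[OF f, of "\<lambda>_. 1"] by simp
  also have "\<dots> \<le> (\<integral>\<^sup>+ x. f x * ennreal d \<partial>M)"
    using mass_L sets_eq_imp_space_eq[OF sets_L] by (intro nn_integral_mono mult_left_mono) auto
  also have "\<dots> = ennreal d * (\<integral>\<^sup>+ x. f x \<partial>M)"
    using f by (simp add: nn_integral_cmult mult.commute)
  finally show ?thesis .
qed

text \<open>
  Almost everywhere statements pass to the kernel, which makes the operator well defined on
  equivalence classes.
\<close>

lemma AE_kernel:
  assumes "AE x in M. P x"
  shows "AE y in N. AE x in K y. P x"
proof -
  obtain Z where Z: "{x \<in> space M. \<not> P x} \<subseteq> Z" "emeasure M Z = 0" "Z \<in> sets M"
    using assms by (rule AE_E)
  have "(\<integral>\<^sup>+ y. (\<integral>\<^sup>+ x. indicator Z x \<partial>K y) \<partial>N) \<le> ennreal d * (\<integral>\<^sup>+ x. indicator Z x \<partial>M)"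
    using Z by (intro nn_integral_kernel_le) auto
  then have "(\<integral>\<^sup>+ y. (\<integral>\<^sup>+ x. indicator Z x \<partial>K y) \<partial>N) = 0"
    using Z by simp
  then have "AE y in N. (\<integral>\<^sup>+ x. indicator Z x \<partial>K y) = 0"
    using Z by (subst (asm) nn_integral_0_iff_AE) (auto intro!: measurable_K)
  then show ?thesis
    using AE_space
  proof eventually_elim
    case (elim y)
    then have "emeasure (K y) Z = 0" using Z sets_K[of y] by simp
    then show ?case
      using Z sets_K[of y] space_K[of y] elim by (intro AE_I[of _ _ Z]) auto
  qed
qed

lemma AE_integrable_powr:
  assumes f[measurable]: "f \<in> borel_measurable M" and "integrable M (\<lambda>x. \<bar>f x\<bar> powr r)"
  shows "AE y in N. integrable (K y) (\<lambda>x. \<bar>f x\<bar> powr r)"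
    and "(\<integral>\<^sup>+ y. (\<integral>\<^sup>+ x. ennreal (\<bar>f x\<bar> powr r) \<partial>K y) \<partial>N)
           \<le> ennreal (d * (\<integral>x. \<bar>f x\<bar> powr r \<partial>M))"
proof -
  have "(\<integral>\<^sup>+ y. (\<integral>\<^sup>+ x. ennreal (\<bar>f x\<bar> powr r) \<partial>K y) \<partial>N)
           \<le> ennreal d * (\<integral>\<^sup>+ x. ennreal (\<bar>f x\<bar> powr r) \<partial>M)"
    by (intro nn_integral_kernel_le) auto
  also have "\<dots> = ennreal (d * (\<integral>x. \<bar>f x\<bar> powr r \<partial>M))"
    using pos assms by (simp add: nn_integral_eq_integral ennreal_mult)
  finally show *: "(\<integral>\<^sup>+ y. (\<integral>\<^sup>+ x. ennreal (\<bar>f x\<bar> powr r) \<partial>K y) \<partial>N)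
           \<le> ennreal (d * (\<integral>x. \<bar>f x\<bar> powr r \<partial>M))" .
  have "AE y in N. (\<integral>\<^sup>+ x. ennreal (\<bar>f x\<bar> powr r) \<partial>K y) \<noteq> \<infinity>"
    using * by (intro nn_integral_PInf_AE measurable_K) (auto simp: top_unique)
  then show "AE y in N. integrable (K y) (\<lambda>x. \<bar>f x\<bar> powr r)"
  proof (rule AE_mp, intro AE_I2 impI)
    fix y assume y: "y \<in> space N" and "(\<integral>\<^sup>+ x. ennreal (\<bar>f x\<bar> powr r) \<partial>K y) \<noteq> \<infinity>"
    then show "integrable (K y) (\<lambda>x. \<bar>f x\<bar> powr r)"
      by (intro integrableI_nonneg) (auto simp: less_top intro!: measurable_from_K)
  qed
qed

lemma finite_measure_K: "y \<in> space N \<Longrightarrow> finite_measure (K y)"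
  using mass_K[of y] space_K[of y] by (intro finite_measureI) (auto simp: top_unique)

end

lemma one_le_enn2real: "1 \<le> p \<Longrightarrow> p \<noteq> \<infinity> \<Longrightarrow> 1 \<le> enn2real p" for p :: ennreal
  by (cases p) auto

text \<open>
  On a null space the essential supremum is \<open>-\<infinity>\<close>; its real value \<open>0\<close> is still a bound.
\<close>

lemma Lp_AE_bound:
  assumes "f \<in> Lp \<infinity> M"
  shows "AE x in M. \<bar>f x\<bar> \<le> Lp_norm \<infinity> M f"
proof -
  have "esssup M (\<lambda>x. ereal \<bar>f x\<bar>) < \<infinity>" using assms by (auto simp: Lp_def)
  then have *: "esssup M (\<lambda>x. ereal \<bar>f x\<bar>) \<le> ereal (Lp_norm \<infinity> M f)"
    by (cases "esssup M (\<lambda>x. ereal \<bar>f x\<bar>)") (auto simp: Lp_norm_def)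
  from esssup_AE[of "\<lambda>x. ereal \<bar>f x\<bar>" M] show ?thesis
  proof (rule AE_mp, intro AE_I2 impI)
    fix x assume "ereal \<bar>f x\<bar> \<le> esssup M (\<lambda>x. ereal \<bar>f x\<bar>)"
    with * have "ereal \<bar>f x\<bar> \<le> ereal (Lp_norm \<infinity> M f)" by (rule order_trans[rotated])
    then show "\<bar>f x\<bar> \<le> Lp_norm \<infinity> M f" by (simp only: ereal_less_eq)
  qed
qed

lemma Lp_infinityI:
  assumes "f \<in> borel_measurable M" "AE x in M. \<bar>f x\<bar> \<le> k" "k \<ge> 0"
  shows "f \<in> Lp \<infinity> M" "Lp_norm \<infinity> M f \<le> k"
proof -
  have "esssup M (\<lambda>x. ereal \<bar>f x\<bar>) \<le> ereal k"
    using assms by (intro esssup_I) auto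
  then show "f \<in> Lp \<infinity> M" "Lp_norm \<infinity> M f \<le> k"
    using assms by (cases "esssup M (\<lambda>x. ereal \<bar>f x\<bar>)"; auto simp: Lp_def Lp_norm_def)+
qed

lemma Lp_norm_infinity_nonneg: "0 \<le> Lp_norm \<infinity> M f"
proof (cases "emeasure M (space M) = 0 \<or> (\<lambda>x. ereal \<bar>f x\<bar>) \<notin> borel_measurable M")
  case True
  then have "esssup M (\<lambda>x. ereal \<bar>f x\<bar>) \<in> {- \<infinity>, \<infinity>}"
    using esssup_zero_space[of M "\<lambda>x. ereal \<bar>f x\<bar>"]
      esssup_non_measurable[of "\<lambda>x. ereal \<bar>f x\<bar>" M]
    by (auto simp: top_ereal_def)
  then show ?thesis
    by (auto simp: Lp_norm_def)
next
  case False
  then have "esssup M (\<lambda>_. 0 :: ereal) \<le> esssup M (\<lambda>x. ereal \<bar>f x\<bar>)"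
    by (intro esssup_mono) auto
  with False show ?thesis by (auto simp: Lp_norm_def esssup_const real_of_ereal_pos)
qed

context transposed_kernels
begin

lemma AE_integrable_kernel:
  assumes f: "f \<in> Lp p M" and p: "1 \<le> p"
  shows "AE y in N. integrable (K y) f"
proof (cases "p = \<infinity>")
  case False
  with f have [measurable]: "f \<in> borel_measurable M"
    and int: "integrable M (\<lambda>x. \<bar>f x\<bar> powr enn2real p)"
    by (auto simp: Lp_def)
  from AE_integrable_powr(1)[OF _ int]
  have "AE y in N. integrable (K y) (\<lambda>x. \<bar>f x\<bar> powr enn2real p)" by simp
  then show ?thesis
  proof (rule AE_mp, intro AE_I2 impI)
    fix y assume y: "y \<in> space N" and i: "integrable (K y) (\<lambda>x. \<bar>f x\<bar> powr enn2real p)"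
    show "integrable (K y) f"
      by (rule integral_powr_le(1)[OF _ pos(1) one_le_enn2real[OF p False] _ i])
        (use y mass_K space_K in \<open>auto intro!: measurable_from_K\<close>)
  qed
next
  case True
  with f have [measurable]: "f \<in> borel_measurable M" by (auto simp: Lp_def)
  have "AE y in N. AE x in K y. \<bar>f x\<bar> \<le> Lp_norm \<infinity> M f"
    using f True by (intro AE_kernel Lp_AE_bound) simp
  then show ?thesis
  proof (rule AE_mp, intro AE_I2 impI)
    fix y assume y: "y \<in> space N" and *: "AE x in K y. \<bar>f x\<bar> \<le> Lp_norm \<infinity> M f"
    interpret finite_measure "K y" using y by (rule finite_measure_K)
    show "integrable (K y) f"
      using * by (intro integrable_const_bound) (auto intro!: measurable_from_K y)
  qed
qed

text \<open>
  The Schur test. For finite \<open>p\<close>, Jensen's inequality against \<open>K\<^sub>y\<close> uses the mass of \<open>K\<close>, and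
  integrating the result over \<open>N\<close> uses the mass of \<open>L\<close>. For \<open>p = \<infinity>\<close> the bound is the mass of \<open>K\<close> alone.
  The operator \<open>F\<close> agrees with integration against \<open>K\<close> only almost everywhere, hence the
  separate measurability hypothesis.
\<close>

theorem Lp_operator_kernel:
  assumes p: "1 \<le> p"
    and F_meas: "\<And>f. f \<in> borel_measurable M \<Longrightarrow> F f \<in> borel_measurable N"
    and F: "\<And>f. f \<in> borel_measurable M \<Longrightarrow> AE y in N. F f y = (\<integral>x. f x \<partial>K y)"
  shows "Lp_operator p M N F"
proof -
  have Lp_meas: "f \<in> borel_measurable M" if "f \<in> Lp p M" for f using that by (simp add: Lp_def)
  have bound: "F f \<in> Lp p N \<and> Lp_norm p N (F f) \<le>
      (if p = \<infinity> then c else (2 powr enn2real p * c powr (enn2real p - 1) * d) powr (1 / enn2real p)) *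
      Lp_norm p M f" if f: "f \<in> Lp p M" for f
  proof (cases "p = \<infinity>")
    case True
    note [measurable] = Lp_meas[OF f]
    define k where "k = Lp_norm \<infinity> M f"
    have k: "k \<ge> 0" by (simp only: k_def Lp_norm_infinity_nonneg)
    have "AE y in N. AE x in K y. \<bar>f x\<bar> \<le> k"
      using Lp_AE_bound[of f M] f True k by (intro AE_kernel) (auto simp: k_def)
    with F[OF Lp_meas[OF f]] AE_space have "AE y in N. \<bar>F f y\<bar> \<le> c * k"
    proof eventually_elim
      case (elim y)
      show ?case
      proof (cases "integrable (K y) f")
        case False
        then show ?thesis using elim pos k by (simp add: not_integrable_integral_eq)
      next
        case True
        have y: "emeasure (K y) (space (K y)) \<le> ennreal c"
          using elim mass_K space_K by simp
        interpret finite_measure "K y"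
          using y by (intro finite_measureI) (auto simp: top_unique)
        have "\<bar>\<integral>x. f x \<partial>K y\<bar> \<le> (\<integral>x. \<bar>f x\<bar> \<partial>K y)" by (rule integral_abs_bound)
        also have "\<dots> \<le> (\<integral>x. k \<partial>K y)"
          using True elim by (intro integral_mono_AE) auto
        also have "\<dots> \<le> c * k"
          using y k pos by (simp add: emeasure_eq_measure mult_right_mono)
        finally show ?thesis using elim by simp
      qed
    qed
    then show ?thesis
      using True Lp_infinityI[of "F f" N "c * k"] F_meas[OF Lp_meas[OF f]] pos k
      by (simp add: k_def)
  next
    case False
    define r where "r = enn2real p"
    have r: "r \<ge> 1" unfolding r_def using p False by (rule one_le_enn2real)
    note fm[measurable] = Lp_meas[OF f]
    note [measurable] = F_meas[OF fm]
    define C where "C = 2 powr r * c powr (r - 1)"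
    have C: "C \<ge> 0" by (simp add: C_def)
    have int: "integrable M (\<lambda>x. \<bar>f x\<bar> powr r)"
      using f False by (auto simp: Lp_def r_def)
    have "AE y in N. ennreal (\<bar>F f y\<bar> powr r) \<le> ennreal C * (\<integral>\<^sup>+ x. ennreal (\<bar>f x\<bar> powr r) \<partial>K y)"
      using F[OF fm] AE_integrable_powr(1)[OF fm int] AE_space
    proof eventually_elim
      case (elim y)
      have "\<bar>F f y\<bar> powr r \<le> C * (\<integral>x. \<bar>f x\<bar> powr r \<partial>K y)"
        unfolding elim C_def
        by (rule integral_powr_le(2)[OF _ pos(1) r])
          (use elim mass_K space_K in \<open>auto intro!: measurable_from_K\<close>)
      then have "ennreal (\<bar>F f y\<bar> powr r) \<le> ennreal (C * (\<integral>x. \<bar>f x\<bar> powr r \<partial>K y))"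
        by (rule ennreal_leI)
      also have "\<dots> = ennreal C * (\<integral>\<^sup>+ x. ennreal (\<bar>f x\<bar> powr r) \<partial>K y)"
        using elim C by (subst nn_integral_eq_integral) (auto simp: ennreal_mult)
      finally show ?case .
    qed
    then have "(\<integral>\<^sup>+ y. ennreal (\<bar>F f y\<bar> powr r) \<partial>N)
        \<le> (\<integral>\<^sup>+ y. ennreal C * (\<integral>\<^sup>+ x. ennreal (\<bar>f x\<bar> powr r) \<partial>K y) \<partial>N)"
      by (rule nn_integral_mono_AE)
    also have "\<dots> = ennreal C * (\<integral>\<^sup>+ y. (\<integral>\<^sup>+ x. ennreal (\<bar>f x\<bar> powr r) \<partial>K y) \<partial>N)"
      by (intro nn_integral_cmult measurable_K) auto
    also have "\<dots> \<le> ennreal C * ennreal (d * (\<integral>x. \<bar>f x\<bar> powr r \<partial>M))"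
      by (intro mult_left_mono AE_integrable_powr(2)[OF fm int]) auto
    also have "\<dots> = ennreal (C * d * (\<integral>x. \<bar>f x\<bar> powr r \<partial>M))"
      using C pos by (simp add: ennreal_mult mult.assoc)
    finally have le: "(\<integral>\<^sup>+ y. ennreal (\<bar>F f y\<bar> powr r) \<partial>N)
        \<le> ennreal (C * d * (\<integral>x. \<bar>f x\<bar> powr r \<partial>M))" .
    have intF: "integrable N (\<lambda>y. \<bar>F f y\<bar> powr r)"
      using le by (intro integrableI_nonneg) (auto simp: order_le_less_trans)
    have "(\<integral>y. \<bar>F f y\<bar> powr r \<partial>N) \<le> C * d * (\<integral>x. \<bar>f x\<bar> powr r \<partial>M)"
      using le intF C pos by (subst (asm) nn_integral_eq_integral) auto
    then have "(\<integral>y. \<bar>F f y\<bar> powr r \<partial>N) powr (1 / r)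
        \<le> (C * d * (\<integral>x. \<bar>f x\<bar> powr r \<partial>M)) powr (1 / r)"
      using r by (intro powr_mono2) auto
    also have "\<dots> = (C * d) powr (1 / r) * (\<integral>x. \<bar>f x\<bar> powr r \<partial>M) powr (1 / r)"
      using C pos by (simp add: powr_mult)
    finally show ?thesis
      using False intF by (simp add: Lp_def Lp_norm_def r_def C_def)
  qed
  have "AE y in N. F f y = F g y" if "f \<in> Lp p M" "g \<in> Lp p M" "AE x in M. f x = g x" for f g
    using F[OF Lp_meas[OF that(1)]] F[OF Lp_meas[OF that(2)]] AE_kernel[OF that(3)] AE_space
  proof eventually_elim
    case (elim y)
    then have "(\<integral>x. f x \<partial>K y) = (\<integral>x. g x \<partial>K y)"
      using Lp_meas that by (intro integral_cong_AE) (auto intro!: measurable_from_K)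
    with elim show ?case by simp
  qed
  moreover have "AE y in N. F (\<lambda>x. a * f x + b * g x) y = a * F f y + b * F g y"
    if "f \<in> Lp p M" "g \<in> Lp p M" for f g a b
  proof -
    note [measurable] = that[THEN Lp_meas]
    have "(\<lambda>x. a * f x + b * g x) \<in> borel_measurable M" by measurable
    from F[OF this] F[OF Lp_meas[OF that(1)]] F[OF Lp_meas[OF that(2)]]
      that[THEN AE_integrable_kernel[OF _ p]]
    show ?thesis by eventually_elim simp
  qed
  ultimately show ?thesis
    using bound unfolding Lp_operator_def by blast
qed

lemma measurable_integral_kernel:
  fixes f :: "'a \<Rightarrow> real"
  assumes [measurable]: "f \<in> borel_measurable M" and nn: "\<And>x. 0 \<le> f x"
  shows "(\<lambda>y. \<integral>x. f x \<partial>K y) \<in> borel_measurable N"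
proof -
  have [measurable]: "(\<lambda>y. \<integral>\<^sup>+ x. ennreal (f x) \<partial>K y) \<in> borel_measurable N"
    by (rule measurable_K) simp
  have "(\<lambda>y. enn2real (\<integral>\<^sup>+ x. ennreal (f x) \<partial>K y)) \<in> borel_measurable N"
    by measurable
  then show ?thesis
    by (rule measurable_cong[THEN iffD1, rotated])
      (auto simp: nn intro!: integral_eq_nn_integral[symmetric] measurable_from_K)
qed

lemma integral_pairing_nonneg:
  fixes f :: "'a \<Rightarrow> real" and g :: "'b \<Rightarrow> real"
  assumes [measurable]: "f \<in> borel_measurable M" "g \<in> borel_measurable N"
    and nn: "\<And>x. 0 \<le> f x" "\<And>y. 0 \<le> g y"
    and int: "AE y in N. integrable (K y) f"
    and fin: "(\<integral>\<^sup>+ y. g y * (\<integral>\<^sup>+ x. f x \<partial>K y) \<partial>N) < \<infinity>"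
  shows "integrable N (\<lambda>y. g y * (\<integral>x. f x \<partial>K y))"
    and "(\<integral>y. g y * (\<integral>x. f x \<partial>K y) \<partial>N) = enn2real (\<integral>\<^sup>+ y. g y * (\<integral>\<^sup>+ x. f x \<partial>K y) \<partial>N)"
proof -
  have [measurable]: "(\<lambda>y. \<integral>x. f x \<partial>K y) \<in> borel_measurable N"
    using nn by (intro measurable_integral_kernel) auto
  have eq: "(\<integral>\<^sup>+ y. ennreal (g y * (\<integral>x. f x \<partial>K y)) \<partial>N) = (\<integral>\<^sup>+ y. g y * (\<integral>\<^sup>+ x. f x \<partial>K y) \<partial>N)"
    by (rule nn_integral_cong_AE)
      (use int in eventually_elim, simp add: nn nn_integral_eq_integral ennreal_mult)
  show "integrable N (\<lambda>y. g y * (\<integral>x. f x \<partial>K y))"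
    using fin by (intro integrableI_nonneg) (auto simp: nn eq)
  show "(\<integral>y. g y * (\<integral>x. f x \<partial>K y) \<partial>N) = enn2real (\<integral>\<^sup>+ y. g y * (\<integral>\<^sup>+ x. f x \<partial>K y) \<partial>N)"
    by (subst integral_eq_nn_integral) (auto simp: nn eq)
qed

text \<open>
  Expresses the pairing through nonnegative integrals of positive and negative parts. To these,
  \<open>transpose\<close> applies directly, and the resulting expression is the same for both orders of
  integration.
\<close>

lemma integral_pairing:
  fixes f :: "'a \<Rightarrow> real" and g :: "'b \<Rightarrow> real"
  assumes fm[measurable]: "f \<in> borel_measurable M" and gm[measurable]: "g \<in> borel_measurable N"
    and Fm[measurable]: "F \<in> borel_measurable N" and F: "AE y in N. F y = (\<integral>x. f x \<partial>K y)"
    and int: "AE y in N. integrable (K y) f"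
    and fin: "(\<integral>\<^sup>+ y. ennreal \<bar>g y\<bar> * (\<integral>\<^sup>+ x. ennreal \<bar>f x\<bar> \<partial>K y) \<partial>N) < \<infinity>"
  defines "P f' g' \<equiv> enn2real (\<integral>\<^sup>+ y. ennreal (g' y) * (\<integral>\<^sup>+ x. ennreal (f' x) \<partial>K y) \<partial>N)"
  shows "(\<integral>y. F y * g y \<partial>N)
    = P (\<lambda>x. max 0 (f x)) (\<lambda>y. max 0 (g y)) - P (\<lambda>x. max 0 (f x)) (\<lambda>y. max 0 (- g y))
    - P (\<lambda>x. max 0 (- f x)) (\<lambda>y. max 0 (g y)) + P (\<lambda>x. max 0 (- f x)) (\<lambda>y. max 0 (- g y))"
proof -
  define I where "I f' g' = (\<lambda>y. g' y * (\<integral>x. f' x \<partial>K y))"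
    for f' :: "'a \<Rightarrow> real" and g' :: "'b \<Rightarrow> real"
  have part: "integrable N (I f' g')" "(\<integral>y. I f' g' y \<partial>N) = P f' g'"
    if [measurable]: "f' \<in> borel_measurable M" "g' \<in> borel_measurable N"
      and f': "\<And>x. 0 \<le> f' x" "\<And>x. f' x \<le> \<bar>f x\<bar>"
      and g': "\<And>y. 0 \<le> g' y" "\<And>y. g' y \<le> \<bar>g y\<bar>" for f' g'
  proof -
    have "(\<integral>\<^sup>+ y. g' y * (\<integral>\<^sup>+ x. f' x \<partial>K y) \<partial>N)
        \<le> (\<integral>\<^sup>+ y. ennreal \<bar>g y\<bar> * (\<integral>\<^sup>+ x. ennreal \<bar>f x\<bar> \<partial>K y) \<partial>N)"
      using f' g' by (intro nn_integral_mono mult_mono) (auto intro!: ennreal_leI)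
    then have le: "(\<integral>\<^sup>+ y. g' y * (\<integral>\<^sup>+ x. f' x \<partial>K y) \<partial>N) < \<infinity>"
      using fin by (rule order_le_less_trans)
    have "AE y in N. integrable (K y) f'"
      using int AE_space
    proof eventually_elim
      case (elim y)
      then show ?case
        using f' by (intro Bochner_Integration.integrable_bound[OF elim(1)])
          (auto intro!: measurable_from_K)
    qed
    from integral_pairing_nonneg[OF that(1,2) f'(1) g'(1) this le]
    show "integrable N (I f' g')" "(\<integral>y. I f' g' y \<partial>N) = P f' g'"
      by (simp_all add: I_def P_def)
  qed
  let ?fp = "\<lambda>x. max 0 (f x)" and ?fn = "\<lambda>x. max 0 (- f x)"
  let ?gp = "\<lambda>y. max 0 (g y)" and ?gn = "\<lambda>y. max 0 (- g y)"
  have "AE y in N. F y * g y = I ?fp ?gp y - I ?fp ?gn y - I ?fn ?gp y + I ?fn ?gn y"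
    using int F
  proof eventually_elim
    case (elim y)
    have "(\<integral>x. f x \<partial>K y) = (\<integral>x. ?fp x - ?fn x \<partial>K y)"
      by (intro Bochner_Integration.integral_cong) auto
    also have "\<dots> = (\<integral>x. ?fp x \<partial>K y) - (\<integral>x. ?fn x \<partial>K y)"
      using elim by (intro Bochner_Integration.integral_diff) auto
    finally have *: "(\<integral>x. f x \<partial>K y) = (\<integral>x. ?fp x \<partial>K y) - (\<integral>x. ?fn x \<partial>K y)" .
    have g: "g y = ?gp y - ?gn y" by auto
    show ?case
      unfolding I_def elim(2) * by (subst g) (simp only: left_diff_distrib right_diff_distrib mult.commute)
  qed
  then have "(\<integral>y. F y * g y \<partial>N)
      = (\<integral>y. I ?fp ?gp y - I ?fp ?gn y - I ?fn ?gp y + I ?fn ?gn y \<partial>N)"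
    using part(1) by (intro integral_cong_AE) (auto intro!: borel_measurable_add borel_measurable_diff)
  also have "\<dots> = P ?fp ?gp - P ?fp ?gn - P ?fn ?gp + P ?fn ?gn"
    using part by simp
  finally show ?thesis .
qed

end

lemma mult_le_powr_add_powr:
  fixes a b :: real
  assumes "r > 1" "s > 1" "1 / r + 1 / s = 1" "a \<ge> 0" "b \<ge> 0"
  shows "a * b \<le> a powr r + b powr s"
proof -
  have "a * b \<le> a powr r / r + b powr s / s"
    using assms by (intro Youngs_inequality) auto
  also have "\<dots> \<le> a powr r / 1 + b powr s / 1"
    using assms by (intro add_mono divide_left_mono) auto
  finally show ?thesis by simp
qed

lemma conjugate_exponents_cases:
  assumes "conjugate_exponents p q" "p < \<infinity>"
  obtains "p = 1" "q = \<infinity>"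
    | "p \<noteq> \<infinity>" "q \<noteq> \<infinity>" "enn2real p > 1" "enn2real q > 1" "1 / enn2real p + 1 / enn2real q = 1"
proof -
  obtain r where r: "p = ennreal r" "r \<ge> 1"
    using assms by (cases p) (auto simp: conjugate_exponents_def)
  show thesis
  proof (cases q)
    case top
    then have "inverse (ennreal r) = 1" using assms r by (simp add: conjugate_exponents_def)
    then have "r = 1" using r by (simp add: inverse_ennreal)
    then show thesis using top r that by simp
  next
    case (real s)
    then have s: "s \<ge> 1" using assms by (auto simp: conjugate_exponents_def)
    have "ennreal (inverse r + inverse s) = 1"
      using assms r s real by (simp add: conjugate_exponents_def inverse_ennreal)
    then have eq: "inverse r + inverse s = 1" by simp
    moreover have "inverse r > 0" "inverse s > 0" using r s by auto
    ultimately have "inverse r < 1" "inverse s < 1" by linarith+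
    then have "r > 1" "s > 1" using r s by (auto simp: inverse_less_1_iff)
    then show thesis using that r real eq s by (simp add: inverse_eq_divide)
  qed
qed

context transposed_kernels
begin

text \<open>
  For \<open>p = 1\<close> the function \<open>g\<close> is bounded. Otherwise \<open>\<bar>f\<bar> \<bar>g\<bar> \<le> \<bar>f\<bar>\<^sup>p + \<bar>g\<bar>\<^sup>q\<close>, where
  the mass of \<open>L\<close> controls the first summand and the mass of \<open>K\<close> the second.
\<close>

lemma nn_integral_pairing_finite:
  assumes pq: "conjugate_exponents p q" "p < \<infinity>" and f: "f \<in> Lp p M" and g: "g \<in> Lp q N"
  shows "(\<integral>\<^sup>+ y. ennreal \<bar>g y\<bar> * (\<integral>\<^sup>+ x. ennreal \<bar>f x\<bar> \<partial>K y) \<partial>N) < \<infinity>"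
proof -
  have fm[measurable]: "f \<in> borel_measurable M" and gm[measurable]: "g \<in> borel_measurable N"
    using f g by (auto simp: Lp_def)
  from pq show ?thesis
  proof (cases rule: conjugate_exponents_cases)
    case 1
    define k where "k = Lp_norm \<infinity> N g"
    have int: "integrable M (\<lambda>x. \<bar>f x\<bar> powr 1)" using f 1 by (auto simp: Lp_def)
    have "AE y in N. \<bar>g y\<bar> \<le> k" using g 1 Lp_AE_bound[of g N] by (simp add: k_def)
    then have "(\<integral>\<^sup>+ y. ennreal \<bar>g y\<bar> * (\<integral>\<^sup>+ x. ennreal \<bar>f x\<bar> \<partial>K y) \<partial>N)
        \<le> (\<integral>\<^sup>+ y. ennreal k * (\<integral>\<^sup>+ x. ennreal \<bar>f x\<bar> \<partial>K y) \<partial>N)"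
      by (intro nn_integral_mono_AE) (auto intro!: mult_right_mono ennreal_leI)
    also have "\<dots> = ennreal k * (\<integral>\<^sup>+ y. (\<integral>\<^sup>+ x. ennreal \<bar>f x\<bar> \<partial>K y) \<partial>N)"
      by (intro nn_integral_cmult measurable_K) auto
    also have "\<dots> < \<infinity>"
      using AE_integrable_powr(2)[OF fm int]
      by (auto simp: ennreal_mult_less_top order_le_less_trans)
    finally show ?thesis .
  next
    case 2
    define r s where "r = enn2real p" and "s = enn2real q"
    have intf: "integrable M (\<lambda>x. \<bar>f x\<bar> powr r)" and intg: "integrable N (\<lambda>y. \<bar>g y\<bar> powr s)"
      using f g 2 by (auto simp: Lp_def r_def s_def)
    have "(\<integral>\<^sup>+ y. ennreal \<bar>g y\<bar> * (\<integral>\<^sup>+ x. ennreal \<bar>f x\<bar> \<partial>K y) \<partial>N)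
        \<le> (\<integral>\<^sup>+ y. (\<integral>\<^sup>+ x. ennreal (\<bar>f x\<bar> powr r) \<partial>K y) + ennreal c * ennreal (\<bar>g y\<bar> powr s) \<partial>N)"
    proof (rule nn_integral_mono)
      fix y assume y: "y \<in> space N"
      have [measurable]: "f \<in> borel_measurable (K y)" using y by (intro measurable_from_K) auto
      have "ennreal \<bar>g y\<bar> * (\<integral>\<^sup>+ x. ennreal \<bar>f x\<bar> \<partial>K y) = (\<integral>\<^sup>+ x. ennreal (\<bar>f x\<bar> * \<bar>g y\<bar>) \<partial>K y)"
        by (subst nn_integral_cmult[symmetric]) (auto simp: ennreal_mult mult.commute)
      also have "\<dots> \<le> (\<integral>\<^sup>+ x. ennreal (\<bar>f x\<bar> powr r) + ennreal (\<bar>g y\<bar> powr s) \<partial>K y)"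
        using 2 by (intro nn_integral_mono)
          (auto simp flip: ennreal_plus intro!: ennreal_leI mult_le_powr_add_powr simp: r_def s_def)
      also have "\<dots> = (\<integral>\<^sup>+ x. ennreal (\<bar>f x\<bar> powr r) \<partial>K y)
          + ennreal (\<bar>g y\<bar> powr s) * emeasure (K y) (space (K y))"
        by (subst nn_integral_add) auto
      also have "\<dots> \<le> (\<integral>\<^sup>+ x. ennreal (\<bar>f x\<bar> powr r) \<partial>K y) + ennreal c * ennreal (\<bar>g y\<bar> powr s)"
        using mass_K[OF y] by (simp add: space_K[OF y] mult.commute mult_right_mono add_left_mono)
      finally show "ennreal \<bar>g y\<bar> * (\<integral>\<^sup>+ x. ennreal \<bar>f x\<bar> \<partial>K y)
          \<le> (\<integral>\<^sup>+ x. ennreal (\<bar>f x\<bar> powr r) \<partial>K y) + ennreal c * ennreal (\<bar>g y\<bar> powr s)" .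
    qed
    also have "\<dots> = (\<integral>\<^sup>+ y. (\<integral>\<^sup>+ x. ennreal (\<bar>f x\<bar> powr r) \<partial>K y) \<partial>N)
        + ennreal c * (\<integral>\<^sup>+ y. ennreal (\<bar>g y\<bar> powr s) \<partial>N)"
      by (subst nn_integral_add) (auto intro!: measurable_K simp: nn_integral_cmult)
    also have "\<dots> < \<infinity>"
      using AE_integrable_powr(2)[OF fm intf] intg
      by (auto simp: nn_integral_eq_integral ennreal_mult_less_top order_le_less_trans)
    finally show ?thesis .
  qed
qed

theorem Lp_dual_operator_kernel:
  assumes pq: "conjugate_exponents p q" "p < \<infinity>"
    and F_meas: "\<And>f. f \<in> borel_measurable M \<Longrightarrow> F f \<in> borel_measurable N"
    and F: "\<And>f. f \<in> borel_measurable M \<Longrightarrow> AE y in N. F f y = (\<integral>x. f x \<partial>K y)"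
    and G_meas: "\<And>g. g \<in> borel_measurable N \<Longrightarrow> G g \<in> borel_measurable M"
    and G: "\<And>g. g \<in> borel_measurable N \<Longrightarrow> AE x in M. G g x = (\<integral>y. g y \<partial>L x)"
  shows "Lp_dual_operator p q M N F G"
proof -
  interpret swapped: transposed_kernels N M L K d c by (rule swap)
  have p: "1 \<le> p" and q: "1 \<le> q" using pq by (auto simp: conjugate_exponents_def)
  have "(\<integral>y. F f y * g y \<partial>N) = (\<integral>x. f x * G g x \<partial>M)" if f: "f \<in> Lp p M" and g: "g \<in> Lp q N" for f g
  proof -
    have fm[measurable]: "f \<in> borel_measurable M" and gm[measurable]: "g \<in> borel_measurable N"
      using f g by (auto simp: Lp_def)
    have fin: "(\<integral>\<^sup>+ y. ennreal \<bar>g y\<bar> * (\<integral>\<^sup>+ x. ennreal \<bar>f x\<bar> \<partial>K y) \<partial>N) < \<infinity>"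
      by (rule nn_integral_pairing_finite[OF pq f g])
    then have fin': "(\<integral>\<^sup>+ x. ennreal \<bar>f x\<bar> * (\<integral>\<^sup>+ y. ennreal \<bar>g y\<bar> \<partial>L x) \<partial>M) < \<infinity>"
      by (subst transpose[symmetric]) auto
    have "(\<integral>y. F f y * g y \<partial>N) = (\<integral>x. G g x * f x \<partial>M)"
      unfolding integral_pairing[OF fm gm F_meas[OF fm] F[OF fm] AE_integrable_kernel[OF f p] fin]
        swapped.integral_pairing[OF gm fm G_meas[OF gm] G[OF gm] swapped.AE_integrable_kernel[OF g q] fin']
      by (simp add: transpose)
    then show ?thesis by (simp add: mult.commute)
  qed
  then show ?thesis
    unfolding Lp_dual_operator_def
    using pq swapped.Lp_operator_kernel[OF q G_meas G] by blast
qed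

end

section \<open>Measurable dependence of locally finite kernels\<close>

text \<open>
  After division by the mass bound the family is a measurable map into the sub-probability
  measures, where measurability of sections is available from the Giry monad.
\<close>

lemma measurable_emeasure_finite_kernel:
  assumes sets: "\<And>t. t \<in> space B \<Longrightarrow> sets (\<kappa> t) = sets R" and ne: "space R \<noteq> {}"
    and meas: "\<And>A. A \<in> sets R \<Longrightarrow> (\<lambda>t. emeasure (\<kappa> t) A) \<in> borel_measurable B"
    and bound: "\<And>t. t \<in> space B \<Longrightarrow> emeasure (\<kappa> t) (space R) \<le> ennreal m"
    and A: "A \<in> sets (B \<Otimes>\<^sub>M R)"
  shows "(\<lambda>t. emeasure (\<kappa> t) (Pair t -` A)) \<in> borel_measurable B"
proof -
  define n where "n = max 1 m"
  have n: "n > 0" "m \<le> n" by (auto simp: n_def)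
  then have inverse_n: "ennreal (1 / n) * ennreal n = 1"
    by (subst ennreal_mult[symmetric]) auto
  define \<mu> where "\<mu> t = scale_measure (ennreal (1 / n)) (\<kappa> t)" for t
  have sp: "space (\<kappa> t) = space R" if "t \<in> space B" for t
    using sets_eq_imp_space_eq[OF sets[OF that]] .
  have kernel: "\<mu> \<in> measurable B (subprob_algebra R)"
  proof (rule measurable_subprob_algebra)
    fix t assume t: "t \<in> space B"
    have "emeasure (\<mu> t) (space (\<mu> t)) \<le> ennreal (1 / n) * ennreal n"
      using order_trans[OF bound[OF t] ennreal_leI[OF n(2)]]
      by (simp add: \<mu>_def space_scale_measure sp[OF t] mult_left_mono)
    also have "\<dots> = 1" using inverse_n .
    finally show "subprob_space (\<mu> t)"
      using ne sp[OF t] by (intro subprob_spaceI) (auto simp: \<mu>_def space_scale_measure)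
  next
    fix A assume "A \<in> sets R"
    note [measurable] = meas[OF this]
    show "(\<lambda>t. emeasure (\<mu> t) A) \<in> borel_measurable B" by (simp add: \<mu>_def)
  qed (simp add: \<mu>_def sets)
  have "(SIGMA t:space B. Pair t -` A) = A"
    using sets.sets_into_space[OF A] by (auto simp: space_pair_measure)
  then have "(\<lambda>t. emeasure (\<mu> t) (Pair t -` A)) \<in> borel_measurable B"
    using kernel A by (intro emeasure_measurable_subprob_algebra2) auto
  then have "(\<lambda>t. ennreal n * emeasure (\<mu> t) (Pair t -` A)) \<in> borel_measurable B"
    by measurable
  moreover have "ennreal n * emeasure (\<mu> t) X = emeasure (\<kappa> t) X" for t X
    using inverse_n by (simp add: \<mu>_def mult.assoc[symmetric] mult.commute)
  ultimately show ?thesis by simp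
qed

lemma Pair_vimage_borel: "A \<in> sets borel \<Longrightarrow> Pair t -` A \<in> sets borel"
  for A :: "('b::second_countable_topology \<times> 'a::second_countable_topology) set"
  using sets_Pair1[of A borel borel t] by (simp only: borel_prod)

text \<open>
  A family of measures that is measurable on fixed Borel sets and, for each parameter, is carried
  by a section of \<open>X\<close> and locally finite there. The measures may be infinite, and their local
  bounds may depend on the parameter in any way.
\<close>

locale locally_finite_kernel =
  fixes \<kappa> :: "'b::second_countable_topology \<Rightarrow> 'a::second_countable_topology measure"
    and X :: "('b \<times> 'a) set"
  assumes sets_kernel: "\<And>t. sets (\<kappa> t) = sets borel"
    and meas_kernel: "\<And>A. A \<in> sets borel \<Longrightarrow> (\<lambda>t. emeasure (\<kappa> t) A) \<in> borel_measurable borel"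
    and X_borel: "X \<in> sets borel"
    and null_outside: "\<And>t. emeasure (\<kappa> t) (- (Pair t -` X)) = 0"
    and locally_finite: "\<And>t z. (t, z) \<in> X \<Longrightarrow> \<exists>U. open U \<and> z \<in> U \<and> emeasure (\<kappa> t) U < \<infinity>"
begin

text \<open>
  Since the neighbourhoods of finite measure can be taken from a countable basis, countably many
  sets \<open>W k\<close>, products of a measurable set of parameters and a basic open set, cover \<open>X\<close>, and
  the restriction of the kernel to each is bounded. Up to a null set, a
  general section is the disjoint union of pieces inside the \<open>W k\<close>.
\<close>

lemma measurable_emeasure:
  assumes A: "A \<in> sets borel"
  shows "(\<lambda>t. emeasure (\<kappa> t) (Pair t -` A)) \<in> borel_measurable borel"
proof -
  obtain \<B> :: "'a set set" where \<B>: "countable \<B>" "topological_basis \<B>"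
    using ex_countable_basis by blast
  define U where "U i = (if \<B> = {} then {} else from_nat_into \<B> i)" for i
  have U_open: "open (U i)" for i
    using \<B> from_nat_into[of \<B> i] topological_basis_open[OF \<B>(2)] by (auto simp: U_def)
  have U_dense: "\<exists>i. z \<in> U i \<and> U i \<subseteq> V" if V: "open V" "z \<in> V" for z V
  proof -
    obtain B where B: "B \<in> \<B>" "z \<in> B" "B \<subseteq> V"
      using topological_basisE[OF \<B>(2) V] by blast
    then obtain i where "from_nat_into \<B> i = B"
      using from_nat_into_surj[OF \<B>(1)] by blast
    with B show ?thesis by (auto simp: U_def intro!: exI[of _ i])
  qed
  define W where
    "W k = {t. emeasure (\<kappa> t) (U (fst (prod_decode k))) \<le> of_nat (snd (prod_decode k))}
             \<times> U (fst (prod_decode k))" for k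
  have W_borel: "W k \<in> sets borel" for k
  proof -
    have [measurable]: "(\<lambda>t. emeasure (\<kappa> t) (U (fst (prod_decode k)))) \<in> borel_measurable borel"
      by (intro meas_kernel) (simp add: U_open)
    have "{t \<in> space borel. emeasure (\<kappa> t) (U (fst (prod_decode k))) \<le> of_nat (snd (prod_decode k))}
        \<in> sets borel"
      by measurable
    then have "W k \<in> sets (borel \<Otimes>\<^sub>M borel)"
      unfolding W_def by (intro pair_measureI) (simp_all add: U_open)
    then show ?thesis by (simp only: borel_prod)
  qed
  have cover: "X \<subseteq> (\<Union>k. W k)"
  proof (clarsimp)
    fix t z assume "(t, z) \<in> X"
    then obtain V where V: "open V" "z \<in> V" "emeasure (\<kappa> t) V < \<infinity>"
      using locally_finite by blast
    obtain i where i: "z \<in> U i" "U i \<subseteq> V" using U_dense[OF V(1,2)] by blast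
    have "emeasure (\<kappa> t) (U i) \<le> emeasure (\<kappa> t) V"
      using i V by (intro emeasure_mono) (auto simp: sets_kernel)
    then have "emeasure (\<kappa> t) (U i) < \<infinity>" using V(3) by (rule order_le_less_trans)
    then obtain m :: nat where "emeasure (\<kappa> t) (U i) \<le> of_nat m"
      using ennreal_Ex_less_of_nat[of "emeasure (\<kappa> t) (U i)"] by (auto dest: less_imp_le)
    then show "\<exists>k. (t, z) \<in> W k"
      using i by (intro exI[of _ "prod_encode (i, m)"]) (simp add: W_def)
  qed
  have piece: "(\<lambda>t. emeasure (\<kappa> t) (Pair t -` D)) \<in> borel_measurable borel"
    if D: "D \<in> sets borel" "D \<subseteq> W k" for D k
  proof -
    define V m where "V = U (fst (prod_decode k))" and "m = snd (prod_decode k)"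
    have V: "V \<in> sets borel" by (simp add: V_def U_open)
    \<comment> \<open>cut down to \<open>W k\<close>, the kernel has mass at most \<open>m\<close>\<close>
    define \<nu> where "\<nu> t = density (\<kappa> t) (indicator (Pair t -` W k))" for t
    have \<nu>: "emeasure (\<nu> t) A = emeasure (\<kappa> t) (A \<inter> Pair t -` W k)" if "A \<in> sets borel" for t A
      using that Pair_vimage_borel[OF W_borel, of t k]
      by (simp add: \<nu>_def emeasure_restricted sets_kernel Int_commute)
    have slice: "Pair t -` W k = (if emeasure (\<kappa> t) V \<le> of_nat m then V else {})" for t
      by (auto simp: W_def V_def m_def)
    have "(\<lambda>t. emeasure (\<nu> t) (Pair t -` D)) \<in> borel_measurable borel"
    proof (rule measurable_emeasure_finite_kernel[where R = borel and m = "real m"])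
      fix A :: "'a set" assume A: "A \<in> sets borel"
      have [measurable]: "(\<lambda>t. emeasure (\<kappa> t) V) \<in> borel_measurable borel"
        "(\<lambda>t. emeasure (\<kappa> t) (A \<inter> V)) \<in> borel_measurable borel"
        using A V by (auto intro!: meas_kernel)
      have "(\<lambda>t. if emeasure (\<kappa> t) V \<le> of_nat m then emeasure (\<kappa> t) (A \<inter> V) else 0)
          \<in> borel_measurable borel"
        by measurable
      then show "(\<lambda>t. emeasure (\<nu> t) A) \<in> borel_measurable borel"
        by (rule measurable_cong[THEN iffD1, rotated]) (simp add: \<nu> A slice)
    next
      fix t show "emeasure (\<nu> t) (space borel) \<le> ennreal (real m)"
        by (simp add: \<nu> slice ennreal_of_nat_eq_real_of_nat)
    next
      show "D \<in> sets (borel \<Otimes>\<^sub>M borel)" using D by (simp only: borel_prod)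
    qed (simp_all add: \<nu>_def sets_kernel)
    moreover have "emeasure (\<nu> t) (Pair t -` D) = emeasure (\<kappa> t) (Pair t -` D)" for t
      using D Pair_vimage_borel[OF D(1)] by (subst \<nu>) (auto intro!: arg_cong2[where f=emeasure])
    ultimately show ?thesis by simp
  qed
  define D where "D k = A \<inter> disjointed W k" for k
  have disj_borel: "disjointed W k \<in> sets borel" for k
    using sets.range_disjointed_sets[of W borel] W_borel by auto
  then have D_borel: "D k \<in> sets borel" for k
    using A by (auto simp: D_def)
  have sums: "emeasure (\<kappa> t) (Pair t -` A) = (\<Sum>k. emeasure (\<kappa> t) (Pair t -` D k))" for t
  proof -
    have "disjoint_family (\<lambda>k. Pair t -` D k)"
      using disjoint_family_disjointed[of W] by (fastforce simp: disjoint_family_on_def D_def)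
    then have "(\<Sum>k. emeasure (\<kappa> t) (Pair t -` D k)) = emeasure (\<kappa> t) (\<Union>k. Pair t -` D k)"
      using Pair_vimage_borel[OF D_borel] by (intro suminf_emeasure) (auto simp: sets_kernel)
    also have "\<dots> = emeasure (\<kappa> t) (Pair t -` A)"
    proof (rule emeasure_eq_AE)
      have "- (Pair t -` X) \<in> null_sets (\<kappa> t)"
        using Pair_vimage_borel[OF X_borel, of t] null_outside[of t]
        by (auto simp: null_sets_def sets_kernel)
      then have "AE z in \<kappa> t. z \<notin> - (Pair t -` X)" by (rule AE_not_in)
      then show "AE z in \<kappa> t. (z \<in> (\<Union>k. Pair t -` D k)) = (z \<in> Pair t -` A)"
        by eventually_elim (use cover in \<open>auto simp: D_def simp flip: UN_disjointed_eq[of W]\<close>)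
    qed (use A D_borel in \<open>auto simp: sets_kernel intro!: Pair_vimage_borel sets.countable_UN\<close>)
    finally show ?thesis by simp
  qed
  have [measurable]: "(\<lambda>t. emeasure (\<kappa> t) (Pair t -` D k)) \<in> borel_measurable borel" for k
    using disjointed_subset[of W k] by (intro piece[OF D_borel]) (auto simp: D_def)
  have "(\<lambda>t. \<Sum>k. emeasure (\<kappa> t) (Pair t -` D k)) \<in> borel_measurable borel"
    by measurable
  then show ?thesis by (simp add: sums)
qed

lemma measurable_slice:
  assumes "f \<in> measurable borel R"
  shows "(\<lambda>z. f (t, z)) \<in> measurable (\<kappa> t) R"
proof -
  have "f \<in> measurable (borel \<Otimes>\<^sub>M borel) R" using assms by (simp only: borel_prod)
  then have "(\<lambda>z. f (t, z)) \<in> measurable borel R" by measurable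
  then show ?thesis using measurable_cong_sets[OF sets_kernel refl] by blast
qed

lemma measurable_nn_integral:
  fixes f :: "'b \<times> 'a \<Rightarrow> ennreal"
  assumes f: "f \<in> borel_measurable borel"
  shows "(\<lambda>t. \<integral>\<^sup>+ z. f (t, z) \<partial>\<kappa> t) \<in> borel_measurable borel"
  using f
proof (induction rule: borel_measurable_induct)
  case (cong f g)
  then show ?case by simp
next
  case (set A)
  have "(\<integral>\<^sup>+ z. indicator A (t, z) \<partial>\<kappa> t) = (\<integral>\<^sup>+ z. indicator (Pair t -` A) z \<partial>\<kappa> t)" for t
    by (intro nn_integral_cong) (simp add: indicator_def)
  moreover have "(\<integral>\<^sup>+ z. indicator (Pair t -` A) z \<partial>\<kappa> t) = emeasure (\<kappa> t) (Pair t -` A)" for t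
    using Pair_vimage_borel[OF set, of t] by (intro nn_integral_indicator) (simp add: sets_kernel)
  ultimately have "(\<integral>\<^sup>+ z. indicator A (t, z) \<partial>\<kappa> t) = emeasure (\<kappa> t) (Pair t -` A)" for t by simp
  then show ?case using measurable_emeasure[OF set] by simp
next
  case (mult u c)
  have "(\<lambda>z. u (t, z)) \<in> borel_measurable (\<kappa> t)" for t
    by (rule measurable_slice) fact
  then show ?case using mult by (simp add: nn_integral_cmult)
next
  case (add u v)
  have "(\<lambda>z. u (t, z)) \<in> borel_measurable (\<kappa> t)" "(\<lambda>z. v (t, z)) \<in> borel_measurable (\<kappa> t)" for t
    by (rule measurable_slice, fact)+
  then show ?case using add by (simp add: nn_integral_add)
next
  case (seq U)
  have "(\<lambda>z. U i (t, z)) \<in> borel_measurable (\<kappa> t)" for t i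
    by (rule measurable_slice) fact
  then have "(\<integral>\<^sup>+ z. (SUP i. U i (t, z)) \<partial>\<kappa> t) = (SUP i. \<integral>\<^sup>+ z. U i (t, z) \<partial>\<kappa> t)" for t
    using seq by (intro nn_integral_monotone_convergence_SUP) (auto simp: incseq_def le_fun_def)
  then show ?case using seq by (simp add: SUP_apply image_comp)
qed

lemma measurable_integral:
  fixes f :: "'b \<times> 'a \<Rightarrow> real"
  assumes f: "f \<in> borel_measurable borel"
  shows "(\<lambda>t. \<integral>z. f (t, z) \<partial>\<kappa> t) \<in> borel_measurable borel"
proof -
  note slice = measurable_slice[OF f]
  have [measurable]: "(\<lambda>t. \<integral>\<^sup>+ z. ennreal \<bar>f (t, z)\<bar> \<partial>\<kappa> t) \<in> borel_measurable borel"
    "(\<lambda>t. \<integral>\<^sup>+ z. ennreal (f (t, z)) \<partial>\<kappa> t) \<in> borel_measurable borel"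
    "(\<lambda>t. \<integral>\<^sup>+ z. ennreal (- f (t, z)) \<partial>\<kappa> t) \<in> borel_measurable borel"
    using measurable_nn_integral[of "\<lambda>w. ennreal \<bar>f w\<bar>"] measurable_nn_integral[of "\<lambda>w. ennreal (f w)"]
      measurable_nn_integral[of "\<lambda>w. ennreal (- f w)"] f by measurable
  have "(\<integral>z. f (t, z) \<partial>\<kappa> t) = (if (\<integral>\<^sup>+ z. ennreal \<bar>f (t, z)\<bar> \<partial>\<kappa> t) < \<infinity>
      then enn2real (\<integral>\<^sup>+ z. ennreal (f (t, z)) \<partial>\<kappa> t) - enn2real (\<integral>\<^sup>+ z. ennreal (- f (t, z)) \<partial>\<kappa> t)
      else 0)" for t
    using slice[of t]
    by (auto simp: integrable_iff_bounded intro!: real_lebesgue_integral_def not_integrable_integral_eq)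
  then show ?thesis by simp
qed

end

section \<open>Radon measures depending on time\<close>

text \<open>
  Measures on the varying spaces \<open>X t\<close>, \<open>t \<in> {0..T}\<close>, are moved to one Borel space, and set to zero
  outside the time interval, so that all of them form a single kernel.
\<close>

definition time_extension :: "real \<Rightarrow> (real \<Rightarrow> 'a::topological_space measure) \<Rightarrow> real \<Rightarrow> 'a measure" where
  "time_extension T \<mu> t = (if t \<in> {0..T} then distr (\<mu> t) borel (\<lambda>z. z) else null_measure borel)"

lemma sets_time_extension [simp, measurable_cong]: "sets (time_extension T \<mu> t) = sets borel"
  and space_time_extension [simp]: "space (time_extension T \<mu> t) = UNIV"
  by (simp_all add: time_extension_def)

lemma measurable_id_radon:
  assumes "radon_measure_on X M"
  shows "(\<lambda>z. z) \<in> measurable M borel"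
proof -
  have "sets M = sets (restrict_space borel X)" using assms by (simp add: radon_measure_on_def)
  moreover have "(\<lambda>z. z) \<in> measurable (restrict_space borel X) borel"
    by (intro measurable_restrict_space1) simp
  ultimately show ?thesis using measurable_cong_sets[of M "restrict_space borel X"] by blast
qed

lemma emeasure_distr_radon:
  assumes M: "radon_measure_on X M" and A: "A \<in> sets borel"
  shows "emeasure (distr M borel (\<lambda>z. z)) A = emeasure M (A \<inter> X)"
proof -
  have "space M = X" using M by (simp add: radon_measure_on_def)
  then show ?thesis by (simp add: emeasure_distr[OF measurable_id_radon[OF M] A])
qed

lemma emeasure_time_extension:
  assumes "radon_measure_on X (\<mu> t)" "t \<in> {0..T}" "A \<in> sets borel"
  shows "emeasure (time_extension T \<mu> t) A = emeasure (\<mu> t) (A \<inter> X)"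
  using assms by (simp add: time_extension_def emeasure_distr_radon)

lemma measurable_emeasure_time_extension:
  assumes family: "measurable_measure_family T X \<mu>"
    and radon: "\<And>t. t \<in> {0..T} \<Longrightarrow> radon_measure_on (X t) (\<mu> t)"
    and A: "A \<in> sets borel"
  shows "(\<lambda>t. emeasure (time_extension T \<mu> t) A) \<in> borel_measurable borel"
proof -
  have "(\<lambda>t. emeasure (\<mu> t) (A \<inter> X t)) \<in> borel_measurable (restrict_space borel {0..T})"
    using family A by (auto simp: measurable_measure_family_def)
  then have "(\<lambda>t. emeasure (\<mu> t) (A \<inter> X t) * indicator {0..T} t) \<in> borel_measurable borel"
    by (subst (asm) borel_measurable_restrict_space_iff_ennreal) auto
  then show ?thesis
    by (rule measurable_cong[THEN iffD1, rotated])
      (auto simp: time_extension_def emeasure_distr_radon[OF radon A] split: split_indicator)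
qed

lemma locally_finite_distr_radon:
  assumes M: "radon_measure_on X M" and z: "z \<in> X"
  shows "\<exists>U. open U \<and> z \<in> U \<and> emeasure (distr M borel (\<lambda>z. z)) U < \<infinity>"
  using M z emeasure_distr_radon[OF M] unfolding radon_measure_on_def by (metis borel_open)

lemma measurable_swap_borel:
  "(\<lambda>(t, z). (z, t)) \<in> measurable borel (borel :: ('a::second_countable_topology \<times> 'b::second_countable_topology) measure)"
  unfolding borel_prod[symmetric] by measurable

locale measurable_radon_family =
  fixes T :: real and I :: "real \<Rightarrow> ((real^2) \<times> real) set"
    and \<sigma> :: "real \<Rightarrow> ((real^2) \<times> real) measure"
  assumes I_meas: "spacetime_params T I \<in> sets borel"
    and radon: "\<And>t. t \<in> {0..T} \<Longrightarrow> radon_measure_on (I t) (\<sigma> t)"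
    and family: "measurable_measure_family T I \<sigma>"
begin

sublocale locally_finite_kernel "time_extension T \<sigma>" "(\<lambda>(t, z). (z, t)) -` spacetime_params T I"
proof
  show P: "(\<lambda>(t, z). (z, t)) -` spacetime_params T I \<in> sets borel"
    using measurable_sets[OF measurable_swap_borel I_meas] by simp
  fix t
  show "emeasure (time_extension T \<sigma> t) (- (Pair t -` (\<lambda>(t, z). (z, t)) -` spacetime_params T I)) = 0"
  proof (cases "t \<in> {0..T}")
    case True
    then have "Pair t -` (\<lambda>(t, z). (z, t)) -` spacetime_params T I = I t"
      by (auto simp: spacetime_params_def)
    then show ?thesis
      using emeasure_time_extension[where \<mu> = \<sigma>, OF radon[OF True] True, of "- I t"] Pair_vimage_borel[OF P, of t]
      by auto
  next
    case False
    then show ?thesis by (simp add: time_extension_def del: atLeastAtMost_iff)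
  qed
  fix z assume "(t, z) \<in> (\<lambda>(t, z). (z, t)) -` spacetime_params T I"
  then have "t \<in> {0..T}" "z \<in> I t" by (auto simp: spacetime_params_def)
  then show "\<exists>U. open U \<and> z \<in> U \<and> emeasure (time_extension T \<sigma> t) U < \<infinity>"
    using locally_finite_distr_radon[OF radon] by (simp add: time_extension_def)
next
  fix A :: "((real^2) \<times> real) set" assume "A \<in> sets borel"
  with family radon show "(\<lambda>t. emeasure (time_extension T \<sigma> t) A) \<in> borel_measurable borel"
    by (rule measurable_emeasure_time_extension)
qed simp

lemma slice_borel:
  assumes "t \<in> {0..T}"
  shows "I t \<in> sets borel"
proof -
  have "Pair t -` (\<lambda>(t, z). (z, t)) -` spacetime_params T I = I t"
    using assms by (auto simp: spacetime_params_def)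
  with Pair_vimage_borel[OF X_borel, of t] show ?thesis by simp
qed

lemma measurable_nn_integral_slice:
  fixes f :: "((real^2) \<times> real) \<times> real \<Rightarrow> ennreal"
  assumes f: "f \<in> borel_measurable borel"
  shows "(\<lambda>t. \<integral>\<^sup>+ z. f (z, t) \<partial>time_extension T \<sigma> t) \<in> borel_measurable borel"
  using measurable_nn_integral[OF measurable_compose[OF measurable_swap_borel f]] by simp

lemma measurable_swapped_slice:
  assumes "f \<in> measurable borel R"
  shows "(\<lambda>z. f (z, t)) \<in> measurable (time_extension T \<sigma> t) R"
  using measurable_slice[OF measurable_compose[OF measurable_swap_borel assms]] by simp

lemma emeasure_spacetime_slice:
  assumes A: "A \<in> sets borel" "A \<subseteq> spacetime_params T I"
  shows "(\<integral>\<^sup>+ t\<in>{0..T}. emeasure (\<sigma> t) {z. (z, t) \<in> A} \<partial>lborel)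
    = (\<integral>\<^sup>+ t. (\<integral>\<^sup>+ z. indicator A (z, t) \<partial>time_extension T \<sigma> t) \<partial>lborel)"
proof (rule nn_integral_cong)
  fix t
  show "emeasure (\<sigma> t) {z. (z, t) \<in> A} * indicator {0..T} t
    = (\<integral>\<^sup>+ z. indicator A (z, t) \<partial>time_extension T \<sigma> t)"
  proof (cases "t \<in> {0..T}")
    case True
    have "(\<lambda>z. indicator A (z, t) :: ennreal) = indicator {z. (z, t) \<in> A}"
      by (auto simp: indicator_def)
    moreover have "{z. (z, t) \<in> A} \<in> sets borel"
      using measurable_sets[OF measurable_Pair2'[of t borel borel], of A] A(1) 
      unfolding borel_prod by (simp add: vimage_def)
    moreover have "{z. (z, t) \<in> A} \<inter> I t = {z. (z, t) \<in> A}"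
      using A(2) by (auto simp: spacetime_params_def)
    ultimately show ?thesis
      using True by (simp add: emeasure_time_extension[where \<mu> = \<sigma>, OF radon])
  next
    case False
    then show ?thesis by (simp add: time_extension_def del: atLeastAtMost_iff)
  qed
qed

lemma space_spacetime [simp]: "space (spacetime_measure T I \<sigma>) = spacetime_params T I"
  unfolding spacetime_measure_def by (rule space_measure_of) (auto simp: sets_restrict_space)

lemma sets_spacetime [simp, measurable_cong]:
  "sets (spacetime_measure T I \<sigma>) = sets (restrict_space borel (spacetime_params T I))"
  unfolding spacetime_measure_def
  using sets.sets_measure_of_eq[of "restrict_space borel (spacetime_params T I)"]
  by (simp add: space_restrict_space)

text \<open>
  The set function defining the space-time measure integrates functions of \<open>t\<close> that are measurable
  by \<open>measurable_nn_integral_slice\<close>. This is what makes it countably additive; from a set function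
  without this property \<open>measure_of\<close> would produce the zero measure.
\<close>

lemma emeasure_spacetime:
  assumes A: "A \<in> sets borel" "A \<subseteq> spacetime_params T I"
  shows "emeasure (spacetime_measure T I \<sigma>) A
    = (\<integral>\<^sup>+ t. (\<integral>\<^sup>+ z. indicator A (z, t) \<partial>time_extension T \<sigma> t) \<partial>lborel)"
proof -
  have sets_iff: "B \<in> sets (restrict_space borel (spacetime_params T I))
      \<longleftrightarrow> B \<in> sets borel \<and> B \<subseteq> spacetime_params T I" for B
    using sets_restrict_space_iff[of "spacetime_params T I" borel B] I_meas by auto
  have "emeasure (spacetime_measure T I \<sigma>) A
      = (\<integral>\<^sup>+ t\<in>{0..T}. emeasure (\<sigma> t) {z. (z, t) \<in> A} \<partial>lborel)"
    unfolding spacetime_measure_def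
  proof (rule emeasure_measure_of_sigma)
    show "sigma_algebra (spacetime_params T I) (sets (restrict_space borel (spacetime_params T I)))"
      using sets.sigma_algebra_axioms[of "restrict_space borel (spacetime_params T I)"]
      by (simp add: space_restrict_space)
    show "positive (sets (restrict_space borel (spacetime_params T I)))
        (\<lambda>A. \<integral>\<^sup>+ t\<in>{0..T}. emeasure (\<sigma> t) {z. (z, t) \<in> A} \<partial>lborel)"
      by (simp add: positive_def)
    show "countably_additive (sets (restrict_space borel (spacetime_params T I)))
        (\<lambda>A. \<integral>\<^sup>+ t\<in>{0..T}. emeasure (\<sigma> t) {z. (z, t) \<in> A} \<partial>lborel)"
    proof (rule countably_additiveI)
      fix A :: "nat \<Rightarrow> (((real^2) \<times> real) \<times> real) set"
      assume "range A \<subseteq> sets (restrict_space borel (spacetime_params T I))" and disj: "disjoint_family A"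
      then have A: "A i \<in> sets borel" "A i \<subseteq> spacetime_params T I" for i
        using sets_iff by blast+
      have ind: "(\<lambda>z. indicator (A i) z :: ennreal) \<in> borel_measurable borel" for i
        using A by simp
      have "(\<Sum>i. \<integral>\<^sup>+ t\<in>{0..T}. emeasure (\<sigma> t) {z. (z, t) \<in> A i} \<partial>lborel)
          = (\<Sum>i. \<integral>\<^sup>+ t. (\<integral>\<^sup>+ z. indicator (A i) (z, t) \<partial>time_extension T \<sigma> t) \<partial>lborel)"
        by (simp only: emeasure_spacetime_slice[OF A])
      also have "\<dots> = (\<integral>\<^sup>+ t. (\<Sum>i. \<integral>\<^sup>+ z. indicator (A i) (z, t) \<partial>time_extension T \<sigma> t) \<partial>lborel)"
        using measurable_nn_integral_slice[OF ind] by (intro nn_integral_suminf[symmetric]) simp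
      also have "\<dots> = (\<integral>\<^sup>+ t. (\<integral>\<^sup>+ z. (\<Sum>i. indicator (A i) (z, t)) \<partial>time_extension T \<sigma> t) \<partial>lborel)"
        using measurable_swapped_slice[OF ind] by (intro nn_integral_cong nn_integral_suminf[symmetric]) simp
      also have "\<dots> = (\<integral>\<^sup>+ t. (\<integral>\<^sup>+ z. indicator (\<Union>i. A i) (z, t) \<partial>time_extension T \<sigma> t) \<partial>lborel)"
        by (simp add: suminf_indicator[OF disj])
      also have "\<dots> = (\<integral>\<^sup>+ t\<in>{0..T}. emeasure (\<sigma> t) {z. (z, t) \<in> (\<Union>i. A i)} \<partial>lborel)"
        using A by (intro emeasure_spacetime_slice[symmetric]) auto
      finally show "(\<Sum>i. \<integral>\<^sup>+ t\<in>{0..T}. emeasure (\<sigma> t) {z. (z, t) \<in> A i} \<partial>lborel)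
          = (\<integral>\<^sup>+ t\<in>{0..T}. emeasure (\<sigma> t) {z. (z, t) \<in> (\<Union>i. A i)} \<partial>lborel)" .
    qed
    show "A \<in> sets (restrict_space borel (spacetime_params T I))" using A sets_iff by blast
  qed
  then show ?thesis by (simp only: emeasure_spacetime_slice[OF A])
qed

lemma time_extension_outside:
  "(\<integral>\<^sup>+ z. f (z, t) \<partial>time_extension T \<sigma> t)
    = (\<integral>\<^sup>+ z. f (z, t) * indicator (spacetime_params T I) (z, t) \<partial>time_extension T \<sigma> t)"
proof (rule nn_integral_cong_AE)
  have "- (Pair t -` (\<lambda>(t, z). (z, t)) -` spacetime_params T I) \<in> null_sets (time_extension T \<sigma> t)"
    using null_outside[of t] Pair_vimage_borel[OF X_borel, of t] by (auto simp: null_sets_def)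
  from AE_not_in[OF this]
  show "AE z in time_extension T \<sigma> t. f (z, t) = f (z, t) * indicator (spacetime_params T I) (z, t)"
    by eventually_elim auto
qed

lemma nn_integral_spacetime:
  fixes f :: "((real^2) \<times> real) \<times> real \<Rightarrow> ennreal"
  assumes f: "f \<in> borel_measurable borel"
  shows "(\<integral>\<^sup>+ y. f y \<partial>spacetime_measure T I \<sigma>)
    = (\<integral>\<^sup>+ t. (\<integral>\<^sup>+ z. f (z, t) \<partial>time_extension T \<sigma> t) \<partial>lborel)"
proof -
  let ?N = "spacetime_measure T I \<sigma>"
  have from_borel: "g \<in> borel_measurable ?N" if "g \<in> borel_measurable borel"
    for g :: "((real^2) \<times> real) \<times> real \<Rightarrow> ennreal"
    using that measurable_cong_sets[OF sets_spacetime refl] measurable_restrict_space1 by blast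
  show ?thesis
    using f
  proof (induction rule: borel_measurable_induct)
    case (cong f g)
    then show ?case by simp
  next
    case (set A)
    have "(\<integral>\<^sup>+ y. indicator A y \<partial>?N) = (\<integral>\<^sup>+ y. indicator (A \<inter> spacetime_params T I) y \<partial>?N)"
      by (intro nn_integral_cong) (simp add: indicator_def)
    also have "\<dots> = emeasure ?N (A \<inter> spacetime_params T I)"
      using set I_meas by (intro nn_integral_indicator) (auto simp: sets_restrict_space)
    also have "\<dots> = (\<integral>\<^sup>+ t. (\<integral>\<^sup>+ z. indicator (A \<inter> spacetime_params T I) (z, t) \<partial>time_extension T \<sigma> t) \<partial>lborel)"
      using set I_meas by (intro emeasure_spacetime) auto
    also have "\<dots> = (\<integral>\<^sup>+ t. (\<integral>\<^sup>+ z. indicator A (z, t) \<partial>time_extension T \<sigma> t) \<partial>lborel)"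
      by (simp only: time_extension_outside[where f = "indicator A"] indicator_inter_arith)
    finally show ?case .
  next
    case (mult u c)
    note u = mult(2)
    show ?case
      by (simp add: nn_integral_cmult from_borel[OF u] measurable_swapped_slice[OF u]
          measurable_nn_integral_slice[OF u] mult(4))
  next
    case (add u v)
    note u = add(1) and v = add(3)
    show ?case
      by (simp add: nn_integral_add from_borel[OF u] measurable_swapped_slice[OF u]
          measurable_nn_integral_slice[OF u] from_borel[OF v] measurable_swapped_slice[OF v]
          measurable_nn_integral_slice[OF v] add.IH)
  next
    case (seq U)
    have "(\<integral>\<^sup>+ y. Sup (range U) y \<partial>?N) = (\<integral>\<^sup>+ y. (SUP i. U i y) \<partial>?N)"
      by (simp add: SUP_apply image_comp)
    also have "\<dots> = (SUP i. \<integral>\<^sup>+ y. U i y \<partial>?N)"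
      by (intro nn_integral_monotone_convergence_SUP from_borel seq(1))
        (use seq(3) in \<open>simp add: incseq_def le_fun_def\<close>)
    also have "\<dots> = (SUP i. \<integral>\<^sup>+ t. (\<integral>\<^sup>+ z. U i (z, t) \<partial>time_extension T \<sigma> t) \<partial>lborel)"
      by (simp only: seq.IH)
    also have "\<dots> = (\<integral>\<^sup>+ t. (SUP i. \<integral>\<^sup>+ z. U i (z, t) \<partial>time_extension T \<sigma> t) \<partial>lborel)"
    proof (rule nn_integral_monotone_convergence_SUP[symmetric])
      show "incseq (\<lambda>i t. \<integral>\<^sup>+ z. U i (z, t) \<partial>time_extension T \<sigma> t)"
        using seq(3) by (auto simp: incseq_def le_fun_def intro!: nn_integral_mono)
      show "(\<lambda>t. \<integral>\<^sup>+ z. U i (z, t) \<partial>time_extension T \<sigma> t) \<in> borel_measurable lborel" for i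
        using measurable_nn_integral_slice[OF seq(1)] by simp
    qed
    also have "\<dots> = (\<integral>\<^sup>+ t. (\<integral>\<^sup>+ z. (SUP i. U i (z, t)) \<partial>time_extension T \<sigma> t) \<partial>lborel)"
    proof (intro nn_integral_cong nn_integral_monotone_convergence_SUP[symmetric])
      show "incseq (\<lambda>i z. U i (z, t))" for t
        using seq(3) by (simp add: incseq_def le_fun_def)
    qed (rule measurable_swapped_slice[OF seq(1)])
    finally show ?case by (simp add: SUP_apply image_comp)
  qed
qed

end

section \<open>The change of variables at a fixed time\<close>

lemma measurable_fst_borel [measurable]: "fst \<in> borel_measurable borel"
  and measurable_snd_borel [measurable]: "snd \<in> borel_measurable borel"
  by (auto intro!: borel_measurable_continuous_onI continuous_intros)

definition rotate_right_angle :: "real^2 \<Rightarrow> real^2" where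
  "rotate_right_angle \<theta> = vector [- (\<theta> $ 2), \<theta> $ 1]"

lemma line_measure_eq:
  "line_measure \<theta> s = distr lborel borel (\<lambda>r. s *\<^sub>R \<theta> + r *\<^sub>R rotate_right_angle \<theta>)"
  by (simp add: line_measure_def rotate_right_angle_def)

lemma measurable_rotate_right_angle [measurable]: "rotate_right_angle \<in> borel_measurable borel"
proof -
  have "linear rotate_right_angle"
    by (rule linearI) (simp_all add: rotate_right_angle_def vec_eq_iff forall_2)
  then show ?thesis
    by (intro borel_measurable_continuous_onI linear_continuous_on linear_conv_bounded_linear[THEN iffD1])
qed

lemma norm_rotate_right_angle: "norm (rotate_right_angle \<theta>) = norm \<theta>"
  and inner_rotate_right_angle: "\<theta> \<bullet> rotate_right_angle \<theta> = 0"
  by (simp_all add: rotate_right_angle_def norm_eq_sqrt_inner inner_vec_def sum_2)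

lemma sets_line_measure [simp, measurable_cong]: "sets (line_measure \<theta> s) = sets borel"
  and space_line_measure [simp]: "space (line_measure \<theta> s) = UNIV"
  by (simp_all add: line_measure_eq)

lemma nn_integral_line:
  assumes "f \<in> borel_measurable borel"
  shows "(\<integral>\<^sup>+ x. f x \<partial>line_measure \<theta> s) = (\<integral>\<^sup>+ r. f (s *\<^sub>R \<theta> + r *\<^sub>R rotate_right_angle \<theta>) \<partial>lborel)"
  using assms by (simp add: line_measure_eq nn_integral_distr)

text \<open>
  In the isometric parametrisation the squared norm of a point is \<open>s\<^sup>2 + r\<^sup>2\<close>, so points of the ball
  have \<open>\<bar>r\<bar> \<le> R\<close>.
\<close>

lemma emeasure_line_le:
  assumes \<theta>: "norm \<theta> = 1" and \<Omega>: "\<Omega> \<in> sets borel" "\<Omega> \<subseteq> cball 0 R" and R: "R \<ge> 0"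
  shows "emeasure (line_measure \<theta> s) \<Omega> \<le> ennreal (2 * R)"
proof -
  have "emeasure (line_measure \<theta> s) \<Omega>
      = emeasure lborel ((\<lambda>r. s *\<^sub>R \<theta> + r *\<^sub>R rotate_right_angle \<theta>) -` \<Omega>)"
    using \<Omega> by (simp add: line_measure_eq emeasure_distr)
  also have "\<dots> \<le> emeasure lborel {-R..R}"
  proof (rule emeasure_mono)
    show "(\<lambda>r. s *\<^sub>R \<theta> + r *\<^sub>R rotate_right_angle \<theta>) -` \<Omega> \<subseteq> {-R..R}"
    proof
      fix r assume "r \<in> (\<lambda>r. s *\<^sub>R \<theta> + r *\<^sub>R rotate_right_angle \<theta>) -` \<Omega>"
      then have le: "norm (s *\<^sub>R \<theta> + r *\<^sub>R rotate_right_angle \<theta>) \<le> R"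
        using \<Omega> by auto
      have "(norm (s *\<^sub>R \<theta> + r *\<^sub>R rotate_right_angle \<theta>))\<^sup>2 = s\<^sup>2 + r\<^sup>2"
        using \<theta> norm_rotate_right_angle[of \<theta>] inner_rotate_right_angle[of \<theta>]
        by (subst norm_add_Pythagorean) (auto simp: orthogonal_def)
      moreover have "(norm (s *\<^sub>R \<theta> + r *\<^sub>R rotate_right_angle \<theta>))\<^sup>2 \<le> R\<^sup>2"
        using le by (intro power_mono) auto
      ultimately have "r\<^sup>2 \<le> R\<^sup>2" using zero_le_power2[of s] by linarith
      then have "\<bar>r\<bar> \<le> R" using R by (simp add: abs_le_square_iff[symmetric])
      then show "r \<in> {-R..R}" by auto
    qed
  qed simp
  finally show ?thesis using R by simp
qed

lemma sigma_finite_distr_radon: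
  fixes X :: "'a::second_countable_topology set"
  assumes M: "radon_measure_on X M" and X: "X \<in> sets borel"
  shows "sigma_finite_measure (distr M borel (\<lambda>z. z))"
proof
  let ?M = "distr M borel (\<lambda>z. z)"
  obtain \<B> :: "'a set set" where \<B>: "countable \<B>" "topological_basis \<B>"
    using ex_countable_basis by blast
  define \<C> where "\<C> = insert (- X) {B \<in> \<B>. emeasure ?M B < \<infinity>}"
  have "UNIV \<subseteq> \<Union>\<C>"
  proof
    fix z show "z \<in> \<Union>\<C>"
    proof (cases "z \<in> X")
      case True
      then obtain U where U: "open U" "z \<in> U" "emeasure ?M U < \<infinity>"
        using locally_finite_distr_radon[OF M] by blast
      obtain B where B: "B \<in> \<B>" "z \<in> B" "B \<subseteq> U"
        using topological_basisE[OF \<B>(2) U(1,2)] by blast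
      have "emeasure ?M B \<le> emeasure ?M U"
        using B U by (intro emeasure_mono) auto
      then have "emeasure ?M B < \<infinity>" using U(3) by (rule order_le_less_trans)
      with B show ?thesis by (auto simp: \<C>_def)
    qed (simp add: \<C>_def)
  qed
  then have "\<Union>\<C> = space ?M" by auto
  moreover have "emeasure ?M (- X) = 0"
    using X emeasure_distr_radon[OF M, of "- X"] by auto
  then have "\<forall>a\<in>\<C>. emeasure ?M a \<noteq> \<infinity>" by (auto simp: \<C>_def)
  moreover have "\<C> \<subseteq> sets ?M"
    using topological_basis_open[OF \<B>(2)] X by (auto simp: \<C>_def)
  moreover have "countable \<C>" using \<B>(1) by (simp add: \<C>_def)
  ultimately show "\<exists>A. countable A \<and> A \<subseteq> sets ?M \<and> \<Union>A = space ?M \<and> (\<forall>a\<in>A. emeasure ?M a \<noteq> \<infinity>)"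
    by blast
qed

lemma integral_iterated_eq_enn2real:
  fixes h :: "'a \<Rightarrow> 'b \<Rightarrow> real"
  assumes h: "\<And>z. z \<in> space \<nu> \<Longrightarrow> h z \<in> borel_measurable (\<mu> z)"
    and nn: "\<And>z x. 0 \<le> h z x"
    and meas: "(\<lambda>z. \<integral>\<^sup>+ x. ennreal (h z x) \<partial>\<mu> z) \<in> borel_measurable \<nu>"
    and fin: "\<And>z. z \<in> space \<nu> \<Longrightarrow> (\<integral>\<^sup>+ x. ennreal (h z x) \<partial>\<mu> z) < \<infinity>"
  shows "(\<integral>z. (\<integral>x. h z x \<partial>\<mu> z) \<partial>\<nu>) = enn2real (\<integral>\<^sup>+ z. (\<integral>\<^sup>+ x. ennreal (h z x) \<partial>\<mu> z) \<partial>\<nu>)"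
proof -
  have "(\<integral>z. (\<integral>x. h z x \<partial>\<mu> z) \<partial>\<nu>) = (\<integral>z. enn2real (\<integral>\<^sup>+ x. ennreal (h z x) \<partial>\<mu> z) \<partial>\<nu>)"
    using h nn by (intro Bochner_Integration.integral_cong integral_eq_nn_integral) auto
  also have "\<dots> = enn2real (\<integral>\<^sup>+ z. ennreal (enn2real (\<integral>\<^sup>+ x. ennreal (h z x) \<partial>\<mu> z)) \<partial>\<nu>)"
    using meas by (intro integral_eq_nn_integral) auto
  also have "(\<integral>\<^sup>+ z. ennreal (enn2real (\<integral>\<^sup>+ x. ennreal (h z x) \<partial>\<mu> z)) \<partial>\<nu>)
      = (\<integral>\<^sup>+ z. (\<integral>\<^sup>+ x. ennreal (h z x) \<partial>\<mu> z) \<partial>\<nu>)"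
    using fin by (intro nn_integral_cong ennreal_enn2real) auto
  finally show ?thesis .
qed

locale radon_change_of_variables =
  fixes \<Omega> :: "(real^2) set" and J :: "((real^2) \<times> real) set"
    and \<sigma> :: "((real^2) \<times> real) measure" and \<eta> :: "(real^2) measure"
    and \<rho> :: "real^2 \<Rightarrow> real" and C R :: real
  assumes \<Omega>_borel [measurable]: "\<Omega> \<in> sets borel" and \<Omega>_sub: "\<Omega> \<subseteq> cball 0 R" and R: "R \<ge> 0"
    and J_borel [measurable]: "J \<in> sets borel" and J_sub: "J \<subseteq> unit_cylinder"
    and \<sigma>_radon: "radon_measure_on J \<sigma>" and \<eta>_radon: "radon_measure_on (directions J) \<eta>"
    and \<eta>_fin: "emeasure \<eta> (directions J) < \<infinity>"
    and \<rho>_meas [measurable]: "\<rho> \<in> borel_measurable borel" and \<rho>_bound: "\<And>x. \<bar>\<rho> x\<bar> \<le> C"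
    and \<rho>_outside: "\<And>x. x \<notin> \<Omega> \<Longrightarrow> \<rho> x = 0"
    and change: "change_of_variables \<Omega> \<sigma> \<eta> \<rho>"
begin

definition "\<sigma>' = distr \<sigma> borel (\<lambda>z. z)"
definition "\<eta>' = distr \<eta> borel (\<lambda>z. z)"

text \<open>
  The two sides of the change of variables, viewed as measures on triples \<open>(x, \<theta>, s)\<close>. The second
  one carries \<open>\<bar>\<rho>\<bar>\<close> in place of \<open>\<rho>\<close> in order to be a measure.
\<close>

definition line_side :: "((real^2) \<times> (real^2) \<times> real) measure" where
  "line_side = density
     (distr (\<sigma>' \<Otimes>\<^sub>M lborel) borel
       (\<lambda>(z, r). (snd z *\<^sub>R fst z + r *\<^sub>R rotate_right_angle (fst z), z)))
     (\<lambda>(x, _). indicator \<Omega> x)"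

definition area_side :: "((real^2) \<times> (real^2) \<times> real) measure" where
  "area_side = density
     (distr (\<eta>' \<Otimes>\<^sub>M lborel) borel (\<lambda>(\<theta>, x). (x, \<theta>, x \<bullet> \<theta>)))
     (\<lambda>(x, _). ennreal \<bar>\<rho> x\<bar>)"

lemma sets_\<sigma>' [simp, measurable_cong]: "sets \<sigma>' = sets borel" by (simp add: \<sigma>'_def)
lemma sets_\<eta>' [simp, measurable_cong]: "sets \<eta>' = sets borel" by (simp add: \<eta>'_def)

sublocale \<sigma>': sigma_finite_measure \<sigma>'
  unfolding \<sigma>'_def by (rule sigma_finite_distr_radon[OF \<sigma>_radon J_borel])

sublocale \<eta>': finite_measure \<eta>'
proof
  have "emeasure \<eta>' UNIV = emeasure \<eta> (directions J)"
    unfolding \<eta>'_def using emeasure_distr_radon[OF \<eta>_radon, of UNIV] by simp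
  moreover have "space \<eta>' = UNIV" by (simp add: \<eta>'_def)
  ultimately show "emeasure \<eta>' (space \<eta>') \<noteq> \<infinity>" using \<eta>_fin by simp
qed

lemma measurable_line_map [measurable]:
  "(\<lambda>(z, r). (snd z *\<^sub>R fst z + r *\<^sub>R rotate_right_angle (fst z), z))
     \<in> borel_measurable (borel \<Otimes>\<^sub>M borel)"
  by measurable

lemma measurable_line_integral:
  fixes \<psi> :: "(real^2) \<times> (real^2) \<times> real \<Rightarrow> ennreal"
  assumes [measurable]: "\<psi> \<in> borel_measurable borel"
  shows "(\<lambda>z. \<integral>\<^sup>+ x. \<psi> (x, z) * indicator \<Omega> x \<partial>line_measure (fst z) (snd z)) \<in> borel_measurable borel"
proof -
  have [measurable]: "(\<lambda>x. \<psi> (x, z)) \<in> borel_measurable borel" for z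
    by measurable
  have "(\<lambda>w. \<psi> w * indicator \<Omega> (fst w)) \<in> borel_measurable borel"
    by measurable
  from measurable_compose[OF measurable_line_map this]
  have "(\<lambda>(z, r). \<psi> (snd z *\<^sub>R fst z + r *\<^sub>R rotate_right_angle (fst z), z)
      * indicator \<Omega> (snd z *\<^sub>R fst z + r *\<^sub>R rotate_right_angle (fst z)))
      \<in> borel_measurable (borel \<Otimes>\<^sub>M borel)"
    by (simp add: case_prod_beta')
  then have "(\<lambda>z. \<integral>\<^sup>+ r. \<psi> (snd z *\<^sub>R fst z + r *\<^sub>R rotate_right_angle (fst z), z)
      * indicator \<Omega> (snd z *\<^sub>R fst z + r *\<^sub>R rotate_right_angle (fst z)) \<partial>lborel) \<in> borel_measurable borel"
    by measurable
  then show ?thesis by (simp add: nn_integral_line)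
qed

lemma nn_integral_line_side:
  fixes \<psi> :: "(real^2) \<times> (real^2) \<times> real \<Rightarrow> ennreal"
  assumes \<psi>[measurable]: "\<psi> \<in> borel_measurable borel"
  shows "(\<integral>\<^sup>+ w. \<psi> w \<partial>line_side)
    = (\<integral>\<^sup>+ z. (\<integral>\<^sup>+ x. \<psi> (x, z) * indicator \<Omega> x \<partial>line_measure (fst z) (snd z)) \<partial>\<sigma>')"
proof -
  have [measurable]: "(\<lambda>x. \<psi> (x, z)) \<in> borel_measurable borel" for z
    by measurable
  have [measurable]: "(\<lambda>(x, _). indicator \<Omega> x :: ennreal)
      \<in> borel_measurable (borel :: ((real^2) \<times> (real^2) \<times> real) measure)"
    by measurable
  let ?\<phi> = "\<lambda>w. \<psi> w * indicator \<Omega> (fst w)"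
  have \<phi>: "?\<phi> \<in> borel_measurable borel"
    by measurable
  let ?m = "\<lambda>(z, r). (snd z *\<^sub>R fst z + r *\<^sub>R rotate_right_angle (fst z), z)"
  have "(\<integral>\<^sup>+ w. \<psi> w \<partial>line_side)
      = (\<integral>\<^sup>+ w. ?\<phi> w \<partial>distr (\<sigma>' \<Otimes>\<^sub>M lborel) borel ?m)"
    unfolding line_side_def by (subst nn_integral_density) (auto simp: case_prod_beta' mult.commute)
  also have "\<dots> = (\<integral>\<^sup>+ p. ?\<phi> (?m p) \<partial>(\<sigma>' \<Otimes>\<^sub>M lborel))"
    using \<phi> by (intro nn_integral_distr) auto
  also have "\<dots> = (\<integral>\<^sup>+ z. (\<integral>\<^sup>+ r. ?\<phi> (?m (z, r)) \<partial>lborel) \<partial>\<sigma>')"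
    using measurable_compose[OF measurable_line_map \<phi>]
    by (intro lborel.nn_integral_fst[symmetric]) simp
  also have "\<dots> = (\<integral>\<^sup>+ z. (\<integral>\<^sup>+ x. \<psi> (x, z) * indicator \<Omega> x \<partial>line_measure (fst z) (snd z)) \<partial>\<sigma>')"
    by (simp add: nn_integral_line)
  finally show ?thesis .
qed

lemma nn_integral_area_side:
  fixes \<psi> :: "(real^2) \<times> (real^2) \<times> real \<Rightarrow> ennreal"
  assumes \<psi>[measurable]: "\<psi> \<in> borel_measurable borel"
  shows "(\<integral>\<^sup>+ w. \<psi> w \<partial>area_side)
    = (\<integral>\<^sup>+ \<theta>. (\<integral>\<^sup>+ x. ennreal \<bar>\<rho> x\<bar> * \<psi> (x, \<theta>, x \<bullet> \<theta>) \<partial>lborel) \<partial>\<eta>')"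
proof -
  have [measurable]: "(\<lambda>(x, _). ennreal \<bar>\<rho> x\<bar>)
      \<in> borel_measurable (borel :: ((real^2) \<times> (real^2) \<times> real) measure)"
    by measurable
  have "(\<integral>\<^sup>+ w. \<psi> w \<partial>area_side) = (\<integral>\<^sup>+ p. (\<lambda>w. (case w of (x, _) \<Rightarrow> ennreal \<bar>\<rho> x\<bar>) * \<psi> w)
      (case p of (\<theta>, x) \<Rightarrow> (x, \<theta>, x \<bullet> \<theta>)) \<partial>(\<eta>' \<Otimes>\<^sub>M lborel))"
    unfolding area_side_def by (subst nn_integral_density) (auto simp: nn_integral_distr)
  also have "\<dots> = (\<integral>\<^sup>+ \<theta>. (\<integral>\<^sup>+ x. ennreal \<bar>\<rho> x\<bar> * \<psi> (x, \<theta>, x \<bullet> \<theta>) \<partial>lborel) \<partial>\<eta>')"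
    by (subst lborel.nn_integral_fst[symmetric]) auto
  finally show ?thesis .
qed

lemma negative_weight_borel:
  "{w :: (real^2) \<times> (real^2) \<times> real. \<rho> (fst w) < 0} \<in> sets borel"
  using measurable_sets[of "\<lambda>w :: (real^2) \<times> (real^2) \<times> real. \<rho> (fst w)" borel borel "{..<0}"]
  by (simp add: vimage_def)

lemma nn_integral_\<sigma>':
  assumes "f \<in> borel_measurable borel"
  shows "(\<integral>\<^sup>+ z. f z \<partial>\<sigma>') = (\<integral>\<^sup>+ z. f z \<partial>\<sigma>)"
  unfolding \<sigma>'_def using assms by (intro nn_integral_distr measurable_id_radon[OF \<sigma>_radon]) simp

lemma nn_integral_\<eta>':
  assumes "f \<in> borel_measurable borel"
  shows "(\<integral>\<^sup>+ \<theta>. f \<theta> \<partial>\<eta>') = (\<integral>\<^sup>+ \<theta>. f \<theta> \<partial>\<eta>)"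
  unfolding \<eta>'_def using assms by (intro nn_integral_distr measurable_id_radon[OF \<eta>_radon]) simp

lemma space_\<sigma>: "space \<sigma> = J"
  using \<sigma>_radon by (simp add: radon_measure_on_def)

lemma sets_line_side [simp]: "sets line_side = sets borel"
  by (simp add: line_side_def)

lemma sets_area_side [simp]: "sets area_side = sets borel"
  by (simp add: area_side_def)

lemma chord_le: "z \<in> J \<Longrightarrow> emeasure (line_measure (fst z) (snd z)) \<Omega> \<le> ennreal (2 * R)"
  using J_sub \<Omega>_sub R by (intro emeasure_line_le) (auto simp: unit_cylinder_def)

lemma emeasure_area_side_finite:
  assumes D: "D \<in> sets borel"
  shows "emeasure area_side D < \<infinity>"
proof -
  have "emeasure area_side D = (\<integral>\<^sup>+ w. indicator D w \<partial>area_side)"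
    using D by simp
  also have "\<dots> = (\<integral>\<^sup>+ \<theta>. (\<integral>\<^sup>+ x. ennreal \<bar>\<rho> x\<bar> * indicator D (x, \<theta>, x \<bullet> \<theta>) \<partial>lborel) \<partial>\<eta>')"
    using D by (intro nn_integral_area_side) simp
  also have "\<dots> \<le> (\<integral>\<^sup>+ \<theta>. (\<integral>\<^sup>+ x. ennreal C * indicator (cball (0 :: real^2) R) x \<partial>lborel) \<partial>\<eta>')"
  proof (intro nn_integral_mono)
    fix \<theta> x
    show "ennreal \<bar>\<rho> x\<bar> * indicator D (x, \<theta>, x \<bullet> \<theta>) \<le> ennreal C * indicator (cball 0 R) x"
      using \<rho>_bound[of x] \<rho>_outside[of x] \<Omega>_sub
      by (cases "x \<in> \<Omega>") (auto simp: indicator_def intro!: ennreal_leI)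
  qed
  also have "\<dots> = ennreal C * emeasure lborel (cball (0 :: real^2) R) * emeasure \<eta>' (space \<eta>')"
    by (simp add: nn_integral_cmult_indicator)
  also have "\<dots> < \<infinity>"
    using emeasure_lborel_cball_finite[of "0 :: real^2" R]
    by (auto simp: ennreal_mult_less_top \<eta>'.emeasure_finite[unfolded infinity_ennreal_def less_top])
  finally show ?thesis .
qed

text \<open>
  The change of variables tested with an indicator. On a set where \<open>\<rho>\<close> has constant sign \<open>c\<close>, the
  signed side is \<open>c\<close> times the measure with density \<open>\<bar>\<rho>\<bar>\<close>.
\<close>

lemma signed_sides:
  assumes D [measurable]: "D \<in> sets borel" and fin: "emeasure line_side D < \<infinity>"
    and c: "\<And>x z. (x, z) \<in> D \<Longrightarrow> \<rho> x = c * \<bar>\<rho> x\<bar>"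
  shows "enn2real (emeasure line_side D) = c * enn2real (emeasure area_side D)"
proof -
  define h where "h z x = indicator \<Omega> x * (indicator D (x, z) :: real)" for z x
  define k where "k \<theta> x = indicator D (x, \<theta>, x \<bullet> \<theta>) * \<bar>\<rho> x\<bar>" for \<theta> :: "real^2" and x
  define \<psi> where "\<psi> x s \<theta> = (indicator D (x, \<theta>, s) :: real)" for x s \<theta>
  have [measurable]: "(indicator D :: _ \<Rightarrow> real) \<in> borel_measurable borel" by simp
  have ind: "(indicator D :: _ \<Rightarrow> ennreal) \<in> borel_measurable borel" by simp
  have h_line: "(\<integral>\<^sup>+ x. ennreal (h z x) \<partial>line_measure (fst z) (snd z))
      = (\<integral>\<^sup>+ x. indicator D (x, z) * indicator \<Omega> x \<partial>line_measure (fst z) (snd z))" for z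
    by (intro nn_integral_cong) (simp add: h_def indicator_def)
  have h_meas: "(\<lambda>z. \<integral>\<^sup>+ x. ennreal (h z x) \<partial>line_measure (fst z) (snd z)) \<in> borel_measurable borel"
    unfolding h_line by (rule measurable_line_integral[OF ind])
  have line: "(\<integral>\<^sup>+ z. (\<integral>\<^sup>+ x. ennreal (h z x) \<partial>line_measure (fst z) (snd z)) \<partial>\<sigma>) = emeasure line_side D"
    unfolding nn_integral_\<sigma>'[OF h_meas, symmetric]
    using nn_integral_line_side[OF ind] by (simp add: h_line)
  have k_meas: "(\<lambda>\<theta>. \<integral>\<^sup>+ x. ennreal (k \<theta> x) \<partial>lborel) \<in> borel_measurable borel"
    unfolding k_def by measurable
  have k_eq: "(\<integral>\<^sup>+ x. ennreal (k \<theta> x) \<partial>lborel)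
      = (\<integral>\<^sup>+ x. ennreal \<bar>\<rho> x\<bar> * indicator D (x, \<theta>, x \<bullet> \<theta>) \<partial>lborel)" for \<theta>
    by (intro nn_integral_cong) (simp add: k_def indicator_def)
  have area: "(\<integral>\<^sup>+ \<theta>. (\<integral>\<^sup>+ x. ennreal (k \<theta> x) \<partial>lborel) \<partial>\<eta>) = emeasure area_side D"
    unfolding nn_integral_\<eta>'[OF k_meas, symmetric]
    using nn_integral_area_side[OF ind] by (simp add: k_eq)
  have k_abs: "ennreal \<bar>\<psi> x (\<theta> \<bullet> x) \<theta> * \<rho> x\<bar> * indicator \<Omega> x = ennreal (k \<theta> x)" for x \<theta>
    using \<rho>_outside[of x] by (auto simp: \<psi>_def k_def indicator_def inner_commute abs_mult)
  have "(\<integral>(\<theta>, s). (LINT x:\<Omega>|line_measure \<theta> s. \<psi> x s \<theta>) \<partial>\<sigma>)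
      = (\<integral>\<theta>. (LINT x:\<Omega>|lborel. \<psi> x (\<theta> \<bullet> x) \<theta> * \<rho> x) \<partial>\<eta>)"
  proof (rule change[unfolded change_of_variables_def, rule_format])
    show "(\<lambda>(x, s, \<theta>). \<psi> x s \<theta>) \<in> borel_measurable borel"
      unfolding \<psi>_def case_prod_beta' by measurable
    have "(\<integral>\<^sup>+ (\<theta>, s). (\<integral>\<^sup>+ x\<in>\<Omega>. ennreal \<bar>\<psi> x s \<theta>\<bar> \<partial>line_measure \<theta> s) \<partial>\<sigma>) = emeasure line_side D"
      unfolding line[symmetric] case_prod_beta'
      by (intro nn_integral_cong) (auto simp: \<psi>_def h_def indicator_def)
    then show "(\<integral>\<^sup>+ (\<theta>, s). (\<integral>\<^sup>+ x\<in>\<Omega>. ennreal \<bar>\<psi> x s \<theta>\<bar> \<partial>line_measure \<theta> s) \<partial>\<sigma>) < \<infinity>"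
      using fin by simp
    show "(\<integral>\<^sup>+ \<theta>. (\<integral>\<^sup>+ x\<in>\<Omega>. ennreal \<bar>\<psi> x (\<theta> \<bullet> x) \<theta> * \<rho> x\<bar> \<partial>lborel) \<partial>\<eta>) < \<infinity>"
      using emeasure_area_side_finite[OF D] by (simp only: k_abs area)
  qed
  also have "(\<integral>(\<theta>, s). (LINT x:\<Omega>|line_measure \<theta> s. \<psi> x s \<theta>) \<partial>\<sigma>)
      = (\<integral>z. (\<integral>x. h z x \<partial>line_measure (fst z) (snd z)) \<partial>\<sigma>)"
    by (simp add: case_prod_beta' set_lebesgue_integral_def \<psi>_def h_def)
  also have "\<dots> = enn2real (emeasure line_side D)"
    unfolding line[symmetric]
  proof (rule integral_iterated_eq_enn2real)
    show "(\<lambda>z. \<integral>\<^sup>+ x. ennreal (h z x) \<partial>line_measure (fst z) (snd z)) \<in> borel_measurable \<sigma>"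
      using measurable_compose[OF measurable_id_radon[OF \<sigma>_radon] h_meas] by simp
    fix z assume "z \<in> space \<sigma>"
    then have z: "z \<in> J" by (simp add: space_\<sigma>)
    have "(\<integral>\<^sup>+ x. ennreal (h z x) \<partial>line_measure (fst z) (snd z))
        \<le> (\<integral>\<^sup>+ x. indicator \<Omega> x \<partial>line_measure (fst z) (snd z))"
      by (intro nn_integral_mono) (simp add: h_def indicator_def)
    also have "\<dots> \<le> ennreal (2 * R)" using chord_le[OF z] by simp
    finally show "(\<integral>\<^sup>+ x. ennreal (h z x) \<partial>line_measure (fst z) (snd z)) < \<infinity>"
      by (simp add: order_le_less_trans)
    show "h z \<in> borel_measurable (line_measure (fst z) (snd z))"
      unfolding h_def by measurable
  qed (simp add: h_def)
  also have "(\<integral>\<theta>. (LINT x:\<Omega>|lborel. \<psi> x (\<theta> \<bullet> x) \<theta> * \<rho> x) \<partial>\<eta>) = (\<integral>\<theta>. (\<integral>x. c * k \<theta> x \<partial>lborel) \<partial>\<eta>)"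
    unfolding set_lebesgue_integral_def
  proof (intro Bochner_Integration.integral_cong refl)
    fix \<theta> x
    show "indicat_real \<Omega> x *\<^sub>R (\<psi> x (\<theta> \<bullet> x) \<theta> * \<rho> x) = c * k \<theta> x"
      using c[of x "(\<theta>, x \<bullet> \<theta>)"] \<rho>_outside[of x]
      by (cases "x \<in> \<Omega>") (auto simp: \<psi>_def k_def indicator_def inner_commute)
  qed
  also have "(\<integral>\<theta>. (\<integral>x. c * k \<theta> x \<partial>lborel) \<partial>\<eta>) = c * (\<integral>\<theta>. (\<integral>x. k \<theta> x \<partial>lborel) \<partial>\<eta>)"
    by simp
  also have "(\<integral>\<theta>. (\<integral>x. k \<theta> x \<partial>lborel) \<partial>\<eta>) = enn2real (emeasure area_side D)"
    unfolding area[symmetric]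
  proof (rule integral_iterated_eq_enn2real)
    show "(\<lambda>\<theta>. \<integral>\<^sup>+ x. ennreal (k \<theta> x) \<partial>lborel) \<in> borel_measurable \<eta>"
      using measurable_compose[OF measurable_id_radon[OF \<eta>_radon] k_meas] by simp
    fix \<theta>
    have "(\<integral>\<^sup>+ x. ennreal (k \<theta> x) \<partial>lborel) \<le> (\<integral>\<^sup>+ x. ennreal C * indicator (cball (0 :: real^2) R) x \<partial>lborel)"
    proof (intro nn_integral_mono)
      fix x show "ennreal (k \<theta> x) \<le> ennreal C * indicator (cball 0 R) x"
        using \<rho>_bound[of x] \<rho>_outside[of x] \<Omega>_sub
        by (cases "x \<in> \<Omega>") (auto simp: k_def indicator_def intro!: ennreal_leI)
    qed
    also have "\<dots> = ennreal C * emeasure lborel (cball (0 :: real^2) R)"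
      by (simp add: nn_integral_cmult_indicator)
    also have "\<dots> < \<infinity>"
      using emeasure_lborel_cball_finite[of "0 :: real^2" R]
      by (simp add: ennreal_mult_less_top less_top)
    finally show "(\<integral>\<^sup>+ x. ennreal (k \<theta> x) \<partial>lborel) < \<infinity>" .
    show "k \<theta> \<in> borel_measurable lborel" unfolding k_def by measurable
  qed (simp add: k_def)
  finally show ?thesis .
qed

text \<open>
  Where \<open>\<rho> < 0\<close>, a nonnegative number equals the negative of a nonnegative number, so both
  vanish. The condition on \<open>E\<close> ensures absolute convergence, since chords have bounded length.
\<close>

lemma sides_agree_on_slab:
  assumes D [measurable]: "D \<in> sets borel" and E [measurable]: "E \<in> sets borel" "emeasure \<sigma>' E < \<infinity>"
    and sub: "D \<subseteq> UNIV \<times> E"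
  shows "emeasure line_side D = emeasure area_side D"
    and "emeasure area_side (D \<inter> {w. \<rho> (fst w) < 0}) = 0"
proof -
  have ind: "(indicator D :: _ \<Rightarrow> ennreal) \<in> borel_measurable borel" by simp
  have "emeasure line_side D = (\<integral>\<^sup>+ w. indicator D w \<partial>line_side)" by simp
  also have "\<dots> = (\<integral>\<^sup>+ z. (\<integral>\<^sup>+ x. indicator D (x, z) * indicator \<Omega> x \<partial>line_measure (fst z) (snd z)) \<partial>\<sigma>)"
    by (simp only: nn_integral_line_side[OF ind] nn_integral_\<sigma>'[OF measurable_line_integral[OF ind]])
  also have "\<dots> \<le> (\<integral>\<^sup>+ z. ennreal (2 * R) * indicator E z \<partial>\<sigma>)"
  proof (rule nn_integral_mono)
    fix z assume "z \<in> space \<sigma>"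
    then have z: "z \<in> J" by (simp add: space_\<sigma>)
    have "(\<integral>\<^sup>+ x. indicator D (x, z) * indicator \<Omega> x \<partial>line_measure (fst z) (snd z))
        \<le> (\<integral>\<^sup>+ x. indicator E z * indicator \<Omega> x \<partial>line_measure (fst z) (snd z))"
      using sub by (intro nn_integral_mono) (auto simp: indicator_def)
    also have "\<dots> = indicator E z * emeasure (line_measure (fst z) (snd z)) \<Omega>"
      by (simp add: nn_integral_cmult)
    also have "\<dots> \<le> indicator E z * ennreal (2 * R)"
      using chord_le[OF z] by (intro mult_left_mono) auto
    finally show "(\<integral>\<^sup>+ x. indicator D (x, z) * indicator \<Omega> x \<partial>line_measure (fst z) (snd z))
        \<le> ennreal (2 * R) * indicator E z" by (simp add: mult.commute)
  qed
  also have "\<dots> = (\<integral>\<^sup>+ z. ennreal (2 * R) * indicator E z \<partial>\<sigma>')"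
    by (intro nn_integral_\<sigma>'[symmetric]) measurable
  also have "\<dots> = ennreal (2 * R) * emeasure \<sigma>' E"
    by (simp add: nn_integral_cmult)
  also have "\<dots> < \<infinity>"
    using E(2) by (simp add: ennreal_mult_less_top less_top)
  finally have fin: "emeasure line_side D < \<infinity>" .
  define P where "P = {w :: (real^2) \<times> (real^2) \<times> real. \<rho> (fst w) < 0}"
  have P [measurable]: "P \<in> sets borel"
    unfolding P_def by (rule negative_weight_borel)
  have fin': "emeasure line_side (D \<inter> X) < \<infinity>" if "X \<in> sets borel" for X
    using that by (intro order_le_less_trans[OF emeasure_mono fin]) auto
  have "enn2real (emeasure line_side (D \<inter> P)) = (-1) * enn2real (emeasure area_side (D \<inter> P))"
    by (rule signed_sides[OF _ fin']) (auto simp: P_def)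
  moreover have "0 \<le> enn2real (emeasure line_side (D \<inter> P))" "0 \<le> enn2real (emeasure area_side (D \<inter> P))"
    by simp_all
  ultimately have "enn2real (emeasure line_side (D \<inter> P)) = 0" "enn2real (emeasure area_side (D \<inter> P)) = 0"
    by linarith+
  then have zero: "emeasure line_side (D \<inter> P) = 0" "emeasure area_side (D \<inter> P) = 0"
    using fin'[of P] emeasure_area_side_finite[of "D \<inter> P"] by (auto simp: enn2real_eq_0_iff)
  then show "emeasure area_side (D \<inter> {w. \<rho> (fst w) < 0}) = 0" by (simp add: P_def)
  have "enn2real (emeasure line_side (D \<inter> - P)) = 1 * enn2real (emeasure area_side (D \<inter> - P))"
    by (rule signed_sides[OF _ fin']) (auto simp: P_def)
  then have eq: "enn2real (emeasure line_side (D \<inter> - P)) = enn2real (emeasure area_side (D \<inter> - P))"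
    by simp
  have "emeasure line_side (D \<inter> - P) = ennreal (enn2real (emeasure line_side (D \<inter> - P)))"
    using fin'[of "- P"] by (intro ennreal_enn2real[symmetric]) auto
  also have "\<dots> = emeasure area_side (D \<inter> - P)"
    unfolding eq using emeasure_area_side_finite[of "D \<inter> - P"] by (intro ennreal_enn2real) auto
  finally have "emeasure line_side (D \<inter> - P) = emeasure area_side (D \<inter> - P)" .
  moreover have "emeasure \<mu> D = emeasure \<mu> (D \<inter> P) + emeasure \<mu> (D \<inter> - P)" if "sets \<mu> = sets borel" for \<mu>
    using that by (subst plus_emeasure) (auto intro!: arg_cong2[where f=emeasure])
  ultimately show "emeasure line_side D = emeasure area_side D"
    using zero by simp
qed

lemma sides_agree: "line_side = area_side"
  and area_side_negative: "emeasure area_side {w. \<rho> (fst w) < 0} = 0"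
proof -
  obtain E :: "nat \<Rightarrow> ((real^2) \<times> real) set" where E: "range E \<subseteq> sets \<sigma>'" "(\<Union>i. E i) = space \<sigma>'"
    "\<And>i. emeasure \<sigma>' (E i) \<noteq> \<infinity>" "incseq E"
    using \<sigma>'.sigma_finite_incseq by blast
  have Eb: "E i \<in> sets borel" for i using E(1) by auto
  have EU: "(\<Union>i. E i) = UNIV" using E(2) by (simp add: \<sigma>'_def)
  have slab: "(UNIV :: (real^2) set) \<times> E i \<in> sets borel" for i
  proof -
    have "(UNIV :: (real^2) set) \<times> E i \<in> sets (borel \<Otimes>\<^sub>M borel)" using Eb by auto
    then show ?thesis by (simp only: borel_prod)
  qed
  have lim: "(SUP i. emeasure \<mu> (A \<inter> UNIV \<times> E i)) = emeasure \<mu> A"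
    if "sets \<mu> = sets borel" "A \<in> sets borel" for \<mu> :: "((real^2) \<times> (real^2) \<times> real) measure" and A
  proof -
    have "(SUP i. emeasure \<mu> (A \<inter> UNIV \<times> E i)) = emeasure \<mu> (\<Union>i. A \<inter> UNIV \<times> E i)"
    proof (rule SUP_emeasure_incseq)
      show "incseq (\<lambda>i. A \<inter> UNIV \<times> E i)"
        using E(4) unfolding incseq_def by blast
    qed (use that slab in auto)
    also have "(\<Union>i. A \<inter> UNIV \<times> E i) = A" using EU by auto
    finally show ?thesis .
  qed
  show "line_side = area_side"
  proof (rule measure_eqI)
    fix A assume "A \<in> sets line_side"
    then have A: "A \<in> sets borel" by simp
    have "emeasure line_side (A \<inter> UNIV \<times> E i) = emeasure area_side (A \<inter> UNIV \<times> E i)" for i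
      using A Eb E(3) slab by (intro sides_agree_on_slab(1)[of _ "E i"]) (auto simp: less_top)
    then show "emeasure line_side A = emeasure area_side A"
      using lim[of line_side A] lim[of area_side A] A by simp
  qed simp
  note P = negative_weight_borel
  have "emeasure area_side (UNIV \<times> E i \<inter> {w. \<rho> (fst w) < 0}) = 0" for i
    using Eb E(3) slab by (intro sides_agree_on_slab(2)[of _ "E i"]) (auto simp: less_top)
  then show "emeasure area_side {w. \<rho> (fst w) < 0} = 0"
    using lim[of area_side, OF _ P] by (simp add: Int_commute)
qed

text \<open>
  The indicator of \<open>J\<close> is free of charge because \<open>\<sigma>\<close> lives on \<open>J\<close>. It matches the restriction to
  \<open>dual_directions\<close> in the dual operator.
\<close>

lemma change_of_variables_nonneg:
  fixes \<psi> :: "(real^2) \<times> (real^2) \<times> real \<Rightarrow> ennreal"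
  assumes \<psi> [measurable]: "\<psi> \<in> borel_measurable borel"
  shows "(\<integral>\<^sup>+ z. (\<integral>\<^sup>+ x. \<psi> (x, z) * indicator \<Omega> x \<partial>line_measure (fst z) (snd z)) \<partial>\<sigma>')
    = (\<integral>\<^sup>+ x. ennreal \<bar>\<rho> x\<bar> * (\<integral>\<^sup>+ \<theta>. \<psi> (x, \<theta>, x \<bullet> \<theta>) * indicator J (\<theta>, x \<bullet> \<theta>) \<partial>\<eta>') \<partial>lborel)"
proof -
  interpret pair_sigma_finite \<eta>' "lborel :: (real^2) measure" ..
  have J: "(\<lambda>w. indicator J (snd w) :: ennreal) \<in> borel_measurable (borel :: ((real^2) \<times> (real^2) \<times> real) measure)"
    by measurable
  define \<psi>' where "\<psi>' w = \<psi> w * indicator J (snd w)" for w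
  have \<psi>' [measurable]: "\<psi>' \<in> borel_measurable borel" unfolding \<psi>'_def using J by measurable
  have "(\<integral>\<^sup>+ z. (\<integral>\<^sup>+ x. \<psi> (x, z) * indicator \<Omega> x \<partial>line_measure (fst z) (snd z)) \<partial>\<sigma>')
      = (\<integral>\<^sup>+ z. (\<integral>\<^sup>+ x. \<psi>' (x, z) * indicator \<Omega> x \<partial>line_measure (fst z) (snd z)) \<partial>\<sigma>')"
    unfolding nn_integral_\<sigma>'[OF measurable_line_integral[OF \<psi>]] nn_integral_\<sigma>'[OF measurable_line_integral[OF \<psi>']]
    by (intro nn_integral_cong) (simp add: \<psi>'_def space_\<sigma>)
  also have "\<dots> = (\<integral>\<^sup>+ \<theta>. (\<integral>\<^sup>+ x. ennreal \<bar>\<rho> x\<bar> * \<psi>' (x, \<theta>, x \<bullet> \<theta>) \<partial>lborel) \<partial>\<eta>')"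
    using nn_integral_line_side[OF \<psi>'] nn_integral_area_side[OF \<psi>'] by (simp add: sides_agree)
  also have "\<dots> = (\<integral>\<^sup>+ x. (\<integral>\<^sup>+ \<theta>. ennreal \<bar>\<rho> x\<bar> * \<psi>' (x, \<theta>, x \<bullet> \<theta>) \<partial>\<eta>') \<partial>lborel)"
    by (intro Fubini'[symmetric]) measurable
  also have "\<dots> = (\<integral>\<^sup>+ x. ennreal \<bar>\<rho> x\<bar> * (\<integral>\<^sup>+ \<theta>. \<psi>' (x, \<theta>, x \<bullet> \<theta>) \<partial>\<eta>') \<partial>lborel)"
    by (intro nn_integral_cong nn_integral_cmult) measurable
  finally show ?thesis by (simp add: \<psi>'_def)
qed

text \<open>
  For almost every \<open>x\<close> with \<open>\<rho> x < 0\<close>, the directions in which \<open>x\<close> is seen form a null set. This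
  allows \<open>\<rho>\<close> and \<open>\<bar>\<rho>\<bar>\<close> to be exchanged in the dual operator.
\<close>

lemma negative_part_unseen:
  "(\<integral>\<^sup>+ x. ennreal \<bar>\<rho> x\<bar> * (indicator {x. \<rho> x < 0} x *
      (\<integral>\<^sup>+ \<theta>. indicator J (\<theta>, x \<bullet> \<theta>) \<partial>\<eta>')) \<partial>lborel) = 0"
proof -
  have [measurable]: "{x. \<rho> x < 0} \<in> sets borel"
    using measurable_sets[OF \<rho>_meas, of "{..<0}"] by (simp add: vimage_def)
  have m: "(\<lambda>w :: (real^2) \<times> (real^2) \<times> real. indicator {x. \<rho> x < 0} (fst w) :: ennreal) \<in> borel_measurable borel"
    by measurable
  note P = negative_weight_borel
  have "(\<integral>\<^sup>+ x. ennreal \<bar>\<rho> x\<bar> * (indicator {x. \<rho> x < 0} x *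
      (\<integral>\<^sup>+ \<theta>. indicator J (\<theta>, x \<bullet> \<theta>) \<partial>\<eta>')) \<partial>lborel)
    = (\<integral>\<^sup>+ x. ennreal \<bar>\<rho> x\<bar> * (\<integral>\<^sup>+ \<theta>. indicator {x. \<rho> x < 0} x * indicator J (\<theta>, x \<bullet> \<theta>) \<partial>\<eta>') \<partial>lborel)"
    by (subst nn_integral_cmult) auto
  also have "\<dots> = (\<integral>\<^sup>+ w. indicator {x. \<rho> x < 0} (fst w) \<partial>line_side)"
    using change_of_variables_nonneg[OF m] nn_integral_line_side[OF m] by simp
  also have "\<dots> = (\<integral>\<^sup>+ w. indicator {w. \<rho> (fst w) < 0} w \<partial>area_side)"
    unfolding sides_agree by (intro nn_integral_cong) (simp add: indicator_def)
  also have "\<dots> = 0" using area_side_negative P by simp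
  finally show ?thesis .
qed

end

section \<open>The dynamic Radon transform and its dual\<close>

locale dynamic_radon_data = measurable_radon_family T I \<sigma>
  for T :: real and I :: "real \<Rightarrow> ((real^2) \<times> real) set"
    and \<sigma> :: "real \<Rightarrow> ((real^2) \<times> real) measure" +
  fixes \<Omega> :: "(real^2) set" and \<eta> :: "real \<Rightarrow> (real^2) measure" and \<rho> :: "real \<Rightarrow> real^2 \<Rightarrow> real"
    and R C\<^sub>\<rho> C\<^sub>\<eta> :: real
  assumes \<Omega>_borel [measurable]: "\<Omega> \<in> sets borel" and \<Omega>_sub: "\<Omega> \<subseteq> cball 0 R"
    and pos: "R > 0" "C\<^sub>\<rho> > 0" "C\<^sub>\<eta> > 0"
    and I_sub: "\<And>t. t \<in> {0..T} \<Longrightarrow> I t \<subseteq> unit_cylinder"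
    and eta_radon: "\<And>t. t \<in> {0..T} \<Longrightarrow> radon_measure_on (directions (I t)) (\<eta> t)"
    and eta_family: "measurable_measure_family T (\<lambda>t. directions (I t)) \<eta>"
    and eta_bound: "\<And>t. t \<in> {0..T} \<Longrightarrow> emeasure (\<eta> t) (directions (I t)) \<le> ennreal C\<^sub>\<eta>"
    and rho_meas: "(\<lambda>(x, t). \<rho> t x) \<in> borel_measurable (restrict_space borel (\<Omega> \<times> {0..T}))"
    and rho_bound: "\<And>t x. t \<in> {0..T} \<Longrightarrow> \<bar>\<rho> t x\<bar> \<le> C\<^sub>\<rho>"
    and rho_outside: "\<And>t x. t \<in> {0..T} \<Longrightarrow> x \<notin> \<Omega> \<Longrightarrow> \<rho> t x = 0"
    and change: "\<And>t. t \<in> {0..T} \<Longrightarrow> change_of_variables \<Omega> (\<sigma> t) (\<eta> t) (\<rho> t)"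
begin

abbreviation "M \<equiv> restrict_space lborel (\<Omega> \<times> {0..T})"
abbreviation "N \<equiv> spacetime_measure T I \<sigma>"
abbreviation "P \<equiv> spacetime_params T I"

definition line_kernel :: "((real^2) \<times> real) \<times> real \<Rightarrow> ((real^2) \<times> real) measure" where
  "line_kernel y = distr (restrict_space (line_measure (fst (fst y)) (snd (fst y))) \<Omega>) M (\<lambda>x. (x, snd y))"

definition direction_kernel :: "(real^2) \<times> real \<Rightarrow> (((real^2) \<times> real) \<times> real) measure" where
  "direction_kernel w = density
     (distr (restrict_space (\<eta> (snd w)) (dual_directions (I (snd w)) (fst w))) N
       (\<lambda>\<theta>. ((\<theta>, fst w \<bullet> \<theta>), snd w)))
     (\<lambda>_. ennreal \<bar>\<rho> (snd w) (fst w)\<bar>)"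

lemma domain_borel [measurable]: "\<Omega> \<times> {0..T} \<in> sets borel"
proof -
  have "\<Omega> \<times> {0..T} \<in> sets (borel \<Otimes>\<^sub>M borel)" by (intro pair_measureI) auto
  then show ?thesis by (simp only: borel_prod)
qed

lemma P_borel [measurable]: "P \<in> sets borel" by (rule I_meas)

lemma mem_P: "(z, t) \<in> P \<longleftrightarrow> t \<in> {0..T} \<and> z \<in> I t"
  by (auto simp: spacetime_params_def)

lemma space_M: "space M = \<Omega> \<times> {0..T}"
  by (simp add: space_restrict_space)

lemma sets_M: "sets M = sets (restrict_space borel (\<Omega> \<times> {0..T}))"
  by (rule sets_restrict_space_cong) simp

lemma measurable_M: "f \<in> measurable M A \<longleftrightarrow> f \<in> measurable (restrict_space borel (\<Omega> \<times> {0..T})) A"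
  using measurable_cong_sets[OF sets_M refl] by blast

lemma measurable_N: "f \<in> measurable N A \<longleftrightarrow> f \<in> measurable (restrict_space borel P) A"
  using measurable_cong_sets[OF sets_spacetime refl] by blast

text \<open>
  Functions on the two subspaces are extended by zero, which turns measurability on a subspace into
  Borel measurability and lets fixed-time statements on the whole space apply.
\<close>

definition extend_M :: "((real^2) \<times> real \<Rightarrow> 'b::{zero}) \<Rightarrow> (real^2) \<times> real \<Rightarrow> 'b" where
  "extend_M f w = (if w \<in> \<Omega> \<times> {0..T} then f w else 0)"

definition extend_N :: "(((real^2) \<times> real) \<times> real \<Rightarrow> 'b::{zero}) \<Rightarrow> ((real^2) \<times> real) \<times> real \<Rightarrow> 'b" where
  "extend_N g y = (if y \<in> P then g y else 0)"

lemma measurable_extend_M: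
  fixes f :: "(real^2) \<times> real \<Rightarrow> 'b::{zero, topological_space}"
  shows "f \<in> borel_measurable M \<Longrightarrow> extend_M f \<in> borel_measurable borel"
  unfolding measurable_M extend_M_def
  by (subst (asm) measurable_restrict_space_iff[where c = 0]) auto

lemma measurable_extend_N:
  fixes g :: "((real^2) \<times> real) \<times> real \<Rightarrow> 'b::{zero, topological_space}"
  shows "g \<in> borel_measurable N \<Longrightarrow> extend_N g \<in> borel_measurable borel"
  unfolding measurable_N extend_N_def
  by (subst (asm) measurable_restrict_space_iff[where c = 0]) auto

definition weight :: "(real^2) \<times> real \<Rightarrow> real" where
  "weight = extend_M (\<lambda>(x, t). \<rho> t x)"

lemma measurable_weight [measurable]: "weight \<in> borel_measurable borel"
  unfolding weight_def by (rule measurable_extend_M) (use rho_meas in \<open>simp only: measurable_M\<close>)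

lemma weight_eq: "t \<in> {0..T} \<Longrightarrow> weight (x, t) = \<rho> t x"
  using rho_outside[of t x] by (auto simp: weight_def extend_M_def)

lemma weight_outside: "w \<notin> \<Omega> \<times> {0..T} \<Longrightarrow> weight w = 0"
  by (simp add: weight_def extend_M_def)

lemma radon_change_of_variables:
  assumes t: "t \<in> {0..T}"
  shows "radon_change_of_variables \<Omega> (I t) (\<sigma> t) (\<eta> t) (\<rho> t) C\<^sub>\<rho> R"
proof
  have "(\<lambda>x. weight (x, t)) \<in> borel_measurable borel" by measurable
  then show "\<rho> t \<in> borel_measurable borel" using weight_eq[OF t] by simp
qed (use t slice_borel radon eta_radon rho_bound rho_outside change I_sub \<Omega>_sub pos
    order_le_less_trans[OF eta_bound] in auto)

lemma measurable_shift_M: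
  assumes "t \<in> {0..T}"
  shows "(\<lambda>x. (x, t)) \<in> measurable (restrict_space (line_measure \<theta> s) \<Omega>) M"
proof -
  have "(\<lambda>x. (x, t)) \<in> measurable (line_measure \<theta> s) borel" by measurable
  then have "(\<lambda>x. (x, t)) \<in> measurable (restrict_space (line_measure \<theta> s) \<Omega>)
      (restrict_space borel (\<Omega> \<times> {0..T}))"
    using assms by (intro measurable_restrict_space2 measurable_restrict_space1)
      (auto simp: space_restrict_space)
  then show ?thesis using measurable_cong_sets[OF refl sets_M] by blast
qed

text \<open>
  Although the projection \<open>directions J\<close> of a Borel set need not be Borel, the set of directions
  seen from a point is a preimage of \<open>J\<close> and therefore Borel.
\<close>

lemma dual_directions_eq: "dual_directions J x = (\<lambda>\<theta>. (\<theta>, x \<bullet> \<theta>)) -` J"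
  by (force simp: dual_directions_def directions_def)

lemma dual_directions_borel:
  assumes "t \<in> {0..T}"
  shows "dual_directions (I t) x \<in> sets borel"
proof -
  have "(\<lambda>\<theta>. (\<theta>, x \<bullet> \<theta>)) \<in> borel_measurable borel" by measurable
  from measurable_sets[OF this slice_borel[OF assms]] show ?thesis by (simp add: dual_directions_eq)
qed

lemma dual_directions_sets:
  assumes "t \<in> {0..T}"
  shows "dual_directions (I t) x \<inter> space (\<eta> t) \<in> sets (\<eta> t)"
  using dual_directions_borel[OF assms, of x] eta_radon[OF assms]
  by (auto simp: radon_measure_on_def sets_restrict_space image_iff Int_commute)

lemma measurable_shift_N:
  assumes t: "t \<in> {0..T}"
  shows "(\<lambda>\<theta>. ((\<theta>, x \<bullet> \<theta>), t)) \<in> measurable (restrict_space (\<eta> t) (dual_directions (I t) x)) N"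
proof -
  have "(\<lambda>\<theta>. ((\<theta>, x \<bullet> \<theta>), t)) \<in> borel_measurable borel" by measurable
  from measurable_compose[OF measurable_id_radon[OF eta_radon[OF t]] this]
  have "(\<lambda>\<theta>. ((\<theta>, x \<bullet> \<theta>), t)) \<in> measurable (restrict_space (\<eta> t) (dual_directions (I t) x))
      (restrict_space borel P)"
    using t by (intro measurable_restrict_space2 measurable_restrict_space1)
      (auto simp: space_restrict_space mem_P dual_directions_eq)
  then show ?thesis using measurable_cong_sets[OF refl sets_spacetime] by blast
qed

lemma nn_integral_line_kernel:
  assumes f: "f \<in> borel_measurable M" and t: "t \<in> {0..T}"
  shows "(\<integral>\<^sup>+ w. f w \<partial>line_kernel (z, t))
    = (\<integral>\<^sup>+ x. extend_M f (x, t) * indicator \<Omega> x \<partial>line_measure (fst z) (snd z))"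
proof -
  have "(\<integral>\<^sup>+ w. f w \<partial>line_kernel (z, t))
      = (\<integral>\<^sup>+ x. f (x, t) * indicator \<Omega> x \<partial>line_measure (fst z) (snd z))"
    unfolding line_kernel_def using measurable_shift_M[OF t] f
    by (subst nn_integral_distr) (auto simp: nn_integral_restrict_space)
  also have "\<dots> = (\<integral>\<^sup>+ x. extend_M f (x, t) * indicator \<Omega> x \<partial>line_measure (fst z) (snd z))"
    using t by (intro nn_integral_cong) (simp add: extend_M_def indicator_def)
  finally show ?thesis .
qed

lemma integral_line_kernel:
  fixes f :: "(real^2) \<times> real \<Rightarrow> real"
  assumes f: "f \<in> borel_measurable M" and t: "t \<in> {0..T}"
  shows "(\<integral>w. f w \<partial>line_kernel (z, t)) = (LINT x:\<Omega>|line_measure (fst z) (snd z). f (x, t))"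
    and "integrable (line_kernel (z, t)) f
      \<longleftrightarrow> set_integrable (line_measure (fst z) (snd z)) \<Omega> (\<lambda>x. f (x, t))"
proof -
  show "(\<integral>w. f w \<partial>line_kernel (z, t)) = (LINT x:\<Omega>|line_measure (fst z) (snd z). f (x, t))"
    unfolding line_kernel_def set_lebesgue_integral_def using measurable_shift_M[OF t] f
    by (subst integral_distr) (auto simp: integral_restrict_space)
  show "integrable (line_kernel (z, t)) f
      \<longleftrightarrow> set_integrable (line_measure (fst z) (snd z)) \<Omega> (\<lambda>x. f (x, t))"
    unfolding line_kernel_def set_integrable_def using measurable_shift_M[OF t] f
    by (subst integrable_distr_eq) (auto simp: integrable_restrict_space)
qed

lemma nn_integral_eta_extension:
  assumes h: "h \<in> borel_measurable borel" and t: "t \<in> {0..T}"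
  shows "(\<integral>\<^sup>+ \<theta>. h \<theta> \<partial>time_extension T \<eta> t) = (\<integral>\<^sup>+ \<theta>. h \<theta> \<partial>\<eta> t)"
proof -
  have "time_extension T \<eta> t = distr (\<eta> t) borel (\<lambda>\<theta>. \<theta>)" using t by (simp add: time_extension_def)
  then show ?thesis
    using h by (simp add: nn_integral_distr measurable_id_radon[OF eta_radon[OF t]])
qed

lemma nn_integral_direction_kernel:
  assumes g: "g \<in> borel_measurable N" and t: "t \<in> {0..T}"
  shows "(\<integral>\<^sup>+ y. g y \<partial>direction_kernel (x, t))
    = ennreal \<bar>\<rho> t x\<bar> * (\<integral>\<^sup>+ \<theta>. extend_N g ((\<theta>, x \<bullet> \<theta>), t) \<partial>time_extension T \<eta> t)"
proof -
  have g': "(\<lambda>\<theta>. extend_N g ((\<theta>, x \<bullet> \<theta>), t)) \<in> borel_measurable borel"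
    using measurable_extend_N[OF g] by measurable
  have "(\<integral>\<^sup>+ y. g y \<partial>direction_kernel (x, t))
      = ennreal \<bar>\<rho> t x\<bar> * (\<integral>\<^sup>+ y. g y \<partial>distr (restrict_space (\<eta> t) (dual_directions (I t) x)) N
          (\<lambda>\<theta>. ((\<theta>, x \<bullet> \<theta>), t)))"
    unfolding direction_kernel_def using g by (simp add: nn_integral_density nn_integral_cmult)
  also have "(\<integral>\<^sup>+ y. g y \<partial>distr (restrict_space (\<eta> t) (dual_directions (I t) x)) N (\<lambda>\<theta>. ((\<theta>, x \<bullet> \<theta>), t)))
      = (\<integral>\<^sup>+ \<theta>. g ((\<theta>, x \<bullet> \<theta>), t) * indicator (dual_directions (I t) x) \<theta> \<partial>\<eta> t)"
    using measurable_shift_N[OF t] g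
    by (simp add: nn_integral_distr nn_integral_restrict_space dual_directions_sets[OF t])
  also have "\<dots> = (\<integral>\<^sup>+ \<theta>. extend_N g ((\<theta>, x \<bullet> \<theta>), t) \<partial>\<eta> t)"
    using t by (intro nn_integral_cong) (simp add: extend_N_def mem_P dual_directions_eq indicator_def)
  also have "\<dots> = (\<integral>\<^sup>+ \<theta>. extend_N g ((\<theta>, x \<bullet> \<theta>), t) \<partial>time_extension T \<eta> t)"
    by (rule nn_integral_eta_extension[OF g' t, symmetric])
  finally show ?thesis .
qed

lemma integral_direction_kernel:
  fixes g :: "((real^2) \<times> real) \<times> real \<Rightarrow> real"
  assumes g: "g \<in> borel_measurable N" and t: "t \<in> {0..T}"
  shows "(\<integral>y. g y \<partial>direction_kernel (x, t))
      = \<bar>\<rho> t x\<bar> * (LINT \<theta>:dual_directions (I t) x|\<eta> t. g ((\<theta>, x \<bullet> \<theta>), t))"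
    and "\<rho> t x \<noteq> 0 \<Longrightarrow> integrable (direction_kernel (x, t)) g
      \<longleftrightarrow> set_integrable (\<eta> t) (dual_directions (I t) x) (\<lambda>\<theta>. g ((\<theta>, x \<bullet> \<theta>), t))"
proof -
  let ?D = "distr (restrict_space (\<eta> t) (dual_directions (I t) x)) N (\<lambda>\<theta>. ((\<theta>, x \<bullet> \<theta>), t))"
  have g': "g \<in> borel_measurable ?D" using g by simp
  have "(\<integral>y. g y \<partial>direction_kernel (x, t)) = (\<integral>y. \<bar>\<rho> t x\<bar> *\<^sub>R g y \<partial>?D)"
    unfolding direction_kernel_def using g' by (simp add: integral_density del: integral_scaleR_right)
  also have "\<dots> = \<bar>\<rho> t x\<bar> * (\<integral>y. g y \<partial>?D)" by simp
  also have "(\<integral>y. g y \<partial>?D) = (LINT \<theta>:dual_directions (I t) x|\<eta> t. g ((\<theta>, x \<bullet> \<theta>), t))"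
    unfolding set_lebesgue_integral_def using measurable_shift_N[OF t] g
    by (simp add: integral_distr integral_restrict_space dual_directions_sets[OF t])
  finally show "(\<integral>y. g y \<partial>direction_kernel (x, t))
      = \<bar>\<rho> t x\<bar> * (LINT \<theta>:dual_directions (I t) x|\<eta> t. g ((\<theta>, x \<bullet> \<theta>), t))" .
  assume "\<rho> t x \<noteq> 0"
  then have "integrable (direction_kernel (x, t)) g \<longleftrightarrow> integrable ?D g"
    unfolding direction_kernel_def using g' by (simp add: integrable_density)
  also have "\<dots> \<longleftrightarrow> set_integrable (\<eta> t) (dual_directions (I t) x) (\<lambda>\<theta>. g ((\<theta>, x \<bullet> \<theta>), t))"
    unfolding set_integrable_def using measurable_shift_N[OF t] g
    by (simp add: integrable_distr_eq integrable_restrict_space dual_directions_sets[OF t])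
  finally show "integrable (direction_kernel (x, t)) g
      \<longleftrightarrow> set_integrable (\<eta> t) (dual_directions (I t) x) (\<lambda>\<theta>. g ((\<theta>, x \<bullet> \<theta>), t))" .
qed

lemma eta_extension_bound: "emeasure (time_extension T \<eta> t) UNIV \<le> ennreal C\<^sub>\<eta>"
proof (cases "t \<in> {0..T}")
  case True
  then show ?thesis
    using emeasure_time_extension[where \<mu> = \<eta>, OF eta_radon[OF True] True, of UNIV] eta_bound by simp
next
  case False
  then show ?thesis by (simp add: time_extension_def del: atLeastAtMost_iff)
qed

sublocale eta_kernel: locally_finite_kernel "\<lambda>w :: (real^2) \<times> real. time_extension T \<eta> (snd w)" UNIV
proof
  fix A :: "(real^2) set" assume A: "A \<in> sets borel"
  show "(\<lambda>w :: (real^2) \<times> real. emeasure (time_extension T \<eta> (snd w)) A) \<in> borel_measurable borel"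
    by (rule measurable_compose[OF measurable_snd_borel
          measurable_emeasure_time_extension[OF eta_family eta_radon A]])
next
  fix w :: "(real^2) \<times> real" and \<theta> :: "real^2"
  have "emeasure (time_extension T \<eta> (snd w)) UNIV < \<infinity>"
    using eta_extension_bound by (rule order_le_less_trans) simp
  then show "\<exists>U. open U \<and> \<theta> \<in> U \<and> emeasure (time_extension T \<eta> (snd w)) U < \<infinity>"
    by (intro exI[of _ UNIV]) simp
qed simp_all

lemma measurable_direction_map:
  "(\<lambda>(w, \<theta>). ((\<theta>, fst w \<bullet> \<theta>), snd w)) \<in> borel_measurable (borel :: (((real^2) \<times> real) \<times> (real^2)) measure)"
  unfolding case_prod_beta' by measurable

lemma measurable_nn_integral_directions:
  fixes g :: "((real^2) \<times> real) \<times> real \<Rightarrow> ennreal"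
  assumes "g \<in> borel_measurable borel"
  shows "(\<lambda>w. \<integral>\<^sup>+ \<theta>. g ((\<theta>, fst w \<bullet> \<theta>), snd w) \<partial>time_extension T \<eta> (snd w)) \<in> borel_measurable borel"
  using eta_kernel.measurable_nn_integral[OF measurable_compose[OF measurable_direction_map assms]] by simp

lemma measurable_nn_integral_lines:
  fixes f :: "(real^2) \<times> real \<Rightarrow> ennreal"
  assumes [measurable]: "f \<in> borel_measurable borel"
  shows "(\<lambda>y. \<integral>\<^sup>+ x. f (x, snd y) * indicator \<Omega> x \<partial>line_measure (fst (fst y)) (snd (fst y)))
    \<in> borel_measurable borel"
proof -
  have "(\<lambda>y. \<integral>\<^sup>+ r. f (snd (fst y) *\<^sub>R fst (fst y) + r *\<^sub>R rotate_right_angle (fst (fst y)), snd y)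
      * indicator \<Omega> (snd (fst y) *\<^sub>R fst (fst y) + r *\<^sub>R rotate_right_angle (fst (fst y))) \<partial>lborel)
    \<in> borel_measurable borel"
    by measurable
  then show ?thesis by (simp add: nn_integral_line)
qed

text \<open>
  On every time slice this is the change of variables for \<open>\<psi>(x, z) = f(x, t) g(z, t)\<close>; the slices are
  then integrated in \<open>t\<close>.
\<close>

lemma transpose_kernels:
  fixes f :: "(real^2) \<times> real \<Rightarrow> ennreal" and g :: "((real^2) \<times> real) \<times> real \<Rightarrow> ennreal"
  assumes f: "f \<in> borel_measurable M" and g: "g \<in> borel_measurable N"
  shows "(\<integral>\<^sup>+ y. g y * (\<integral>\<^sup>+ w. f w \<partial>line_kernel y) \<partial>N) = (\<integral>\<^sup>+ w. f w * (\<integral>\<^sup>+ y. g y \<partial>direction_kernel w) \<partial>M)"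
proof -
  note fm [measurable] = measurable_extend_M[OF f]
  note gm [measurable] = measurable_extend_N[OF g]
  let ?f = "extend_M f" and ?g = "extend_N g"
  define H where "H y = (\<integral>\<^sup>+ x. ?f (x, snd y) * indicator \<Omega> x \<partial>line_measure (fst (fst y)) (snd (fst y)))" for y
  define B where "B w = (\<integral>\<^sup>+ \<theta>. ?g ((\<theta>, fst w \<bullet> \<theta>), snd w) \<partial>time_extension T \<eta> (snd w))" for w
  have [measurable]: "H \<in> borel_measurable borel"
    unfolding H_def by (rule measurable_nn_integral_lines[OF fm])
  have [measurable]: "B \<in> borel_measurable borel"
    unfolding B_def by (rule measurable_nn_integral_directions[OF gm])
  have "(\<integral>\<^sup>+ y. g y * (\<integral>\<^sup>+ w. f w \<partial>line_kernel y) \<partial>N) = (\<integral>\<^sup>+ y. ?g y * H y \<partial>N)"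
  proof (rule nn_integral_cong)
    fix y assume "y \<in> space N"
    then obtain z t where y: "y = (z, t)" "t \<in> {0..T}" "y \<in> P" by (auto simp: spacetime_params_def)
    then show "g y * (\<integral>\<^sup>+ w. f w \<partial>line_kernel y) = ?g y * H y"
      using nn_integral_line_kernel[OF f y(2), of z] by (simp add: H_def extend_N_def)
  qed
  also have "\<dots> = (\<integral>\<^sup>+ t. (\<integral>\<^sup>+ z. ?g (z, t) * H (z, t) \<partial>time_extension T \<sigma> t) \<partial>lborel)"
    by (rule nn_integral_spacetime) measurable
  also have "\<dots> = (\<integral>\<^sup>+ t. (\<integral>\<^sup>+ x. ennreal \<bar>weight (x, t)\<bar> * (?f (x, t) * B (x, t)) \<partial>lborel) \<partial>lborel)"
  proof (rule nn_integral_cong)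
    fix t
    show "(\<integral>\<^sup>+ z. ?g (z, t) * H (z, t) \<partial>time_extension T \<sigma> t)
        = (\<integral>\<^sup>+ x. ennreal \<bar>weight (x, t)\<bar> * (?f (x, t) * B (x, t)) \<partial>lborel)"
    proof (cases "t \<in> {0..T}")
      case False
      then show ?thesis
        by (simp add: time_extension_def weight_outside del: atLeastAtMost_iff)
    next
      case True
      interpret C: radon_change_of_variables \<Omega> "I t" "\<sigma> t" "\<eta> t" "\<rho> t" C\<^sub>\<rho> R
        by (rule radon_change_of_variables[OF True])
      have ext: "C.\<sigma>' = time_extension T \<sigma> t" "C.\<eta>' = time_extension T \<eta> t"
        using True by (simp_all add: C.\<sigma>'_def C.\<eta>'_def time_extension_def)
      define \<psi> where "\<psi> w = ?f (fst w, t) * ?g (snd w, t)" for w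
      have \<psi>: "\<psi> \<in> borel_measurable borel" unfolding \<psi>_def by measurable
      have "(\<integral>\<^sup>+ z. ?g (z, t) * H (z, t) \<partial>time_extension T \<sigma> t)
          = (\<integral>\<^sup>+ z. (\<integral>\<^sup>+ x. \<psi> (x, z) * indicator \<Omega> x \<partial>line_measure (fst z) (snd z)) \<partial>C.\<sigma>')"
        unfolding ext H_def
        by (intro nn_integral_cong) (simp add: nn_integral_cmult[symmetric] \<psi>_def mult_ac)
      also have "\<dots> = (\<integral>\<^sup>+ x. ennreal \<bar>\<rho> t x\<bar> * (\<integral>\<^sup>+ \<theta>. \<psi> (x, \<theta>, x \<bullet> \<theta>) * indicator (I t) (\<theta>, x \<bullet> \<theta>)
          \<partial>time_extension T \<eta> t) \<partial>lborel)"
        using C.change_of_variables_nonneg[OF \<psi>] by (simp only: ext)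
      also have "\<dots> = (\<integral>\<^sup>+ x. ennreal \<bar>weight (x, t)\<bar> * (?f (x, t) * B (x, t)) \<partial>lborel)"
      proof (rule nn_integral_cong)
        fix x
        have "(\<integral>\<^sup>+ \<theta>. \<psi> (x, \<theta>, x \<bullet> \<theta>) * indicator (I t) (\<theta>, x \<bullet> \<theta>) \<partial>time_extension T \<eta> t)
            = (\<integral>\<^sup>+ \<theta>. ?f (x, t) * ?g ((\<theta>, x \<bullet> \<theta>), t) \<partial>time_extension T \<eta> t)"
          by (intro nn_integral_cong) (simp add: \<psi>_def extend_N_def mem_P indicator_def)
        also have "\<dots> = ?f (x, t) * B (x, t)"
          unfolding B_def by (simp add: nn_integral_cmult)
        finally show "ennreal \<bar>\<rho> t x\<bar> * (\<integral>\<^sup>+ \<theta>. \<psi> (x, \<theta>, x \<bullet> \<theta>) * indicator (I t) (\<theta>, x \<bullet> \<theta>)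
            \<partial>time_extension T \<eta> t) = ennreal \<bar>weight (x, t)\<bar> * (?f (x, t) * B (x, t))"
          by (simp add: weight_eq[OF True])
      qed
      finally show ?thesis .
    qed
  qed
  also have "\<dots> = (\<integral>\<^sup>+ w. ennreal \<bar>weight w\<bar> * (?f w * B w) \<partial>lborel)"
  proof -
    have "(\<lambda>w. ennreal \<bar>weight w\<bar> * (?f w * B w)) \<in> borel_measurable borel" by measurable
    then have "(\<lambda>w. ennreal \<bar>weight w\<bar> * (?f w * B w)) \<in> borel_measurable (lborel \<Otimes>\<^sub>M lborel)"
      by (simp add: lborel_prod)
    from lborel_pair.nn_integral_snd[OF this] show ?thesis by (simp only: lborel_prod)
  qed
  also have "\<dots> = (\<integral>\<^sup>+ w. f w * (\<integral>\<^sup>+ y. g y \<partial>direction_kernel w) \<partial>M)"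
  proof -
    have "ennreal \<bar>weight w\<bar> * (?f w * B w)
        = f w * (\<integral>\<^sup>+ y. g y \<partial>direction_kernel w) * indicator (\<Omega> \<times> {0..T}) w" for w
    proof (cases "w \<in> \<Omega> \<times> {0..T}")
      case True
      then obtain x t where w: "w = (x, t)" "t \<in> {0..T}" "x \<in> \<Omega>" by auto
      show ?thesis
        using nn_integral_direction_kernel[OF g w(2), of x] True w
        by (simp add: B_def extend_M_def weight_eq mult_ac del: atLeastAtMost_iff)
    next
      case False
      then show ?thesis by (simp add: weight_outside del: mem_Times_iff)
    qed
    then show ?thesis by (simp add: nn_integral_restrict_space)
  qed
  finally show ?thesis .
qed

text \<open>
  The integral of \<open>negative_part_unseen\<close> in time: at almost every point where \<open>\<rho>\<close> is negative the
  dual operator integrates over a null set of directions.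
\<close>

lemma AE_direction_kernel_zero:
  "AE w in M. \<rho> (snd w) (fst w) \<ge> 0 \<or>
     (\<forall>g :: _ \<Rightarrow> real. (LINT \<theta>:dual_directions (I (snd w)) (fst w)|\<eta> (snd w). g ((\<theta>, fst w \<bullet> \<theta>), snd w)) = 0)"
proof -
  define m where "m w = (\<integral>\<^sup>+ \<theta>. indicator P ((\<theta>, fst w \<bullet> \<theta>), snd w) \<partial>time_extension T \<eta> (snd w))" for w
  have m [measurable]: "m \<in> borel_measurable borel"
    unfolding m_def by (rule measurable_nn_integral_directions) simp
  define h where "h w = ennreal \<bar>weight w\<bar> * (indicator {w. weight w < 0} w * m w)" for w
  have [measurable]: "{w. weight w < 0} \<in> sets borel"
    using measurable_sets[OF measurable_weight, of "{..<0}"] by (simp add: vimage_def)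
  have h: "h \<in> borel_measurable borel" unfolding h_def by measurable
  have "(\<integral>\<^sup>+ w. h w \<partial>lborel) = (\<integral>\<^sup>+ t. (\<integral>\<^sup>+ x. h (x, t) \<partial>lborel) \<partial>lborel)"
  proof -
    have "h \<in> borel_measurable (lborel \<Otimes>\<^sub>M lborel)" using h by (simp add: lborel_prod)
    from lborel_pair.nn_integral_snd[OF this] show ?thesis by (simp only: lborel_prod)
  qed
  also have "\<dots> = (\<integral>\<^sup>+ t. 0 \<partial>(lborel :: real measure))"
  proof (rule nn_integral_cong)
    fix t :: real
    show "(\<integral>\<^sup>+ x. h (x, t) \<partial>lborel) = 0"
    proof (cases "t \<in> {0..T}")
      case False
      then show ?thesis by (simp add: h_def weight_outside del: atLeastAtMost_iff)
    next
      case True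
      interpret C: radon_change_of_variables \<Omega> "I t" "\<sigma> t" "\<eta> t" "\<rho> t" C\<^sub>\<rho> R
        by (rule radon_change_of_variables[OF True])
      have ext: "C.\<eta>' = time_extension T \<eta> t"
        using True by (simp add: C.\<eta>'_def time_extension_def)
      have "indicator P ((\<theta>, x \<bullet> \<theta>), t) = (indicator (I t) (\<theta>, x \<bullet> \<theta>) :: ennreal)" for x \<theta>
        using True by (simp add: mem_P indicator_def)
      then show ?thesis
        using C.negative_part_unseen
        by (simp add: h_def m_def ext weight_eq[OF True] indicator_def)
    qed
  qed
  finally have "AE w in lborel. h w = 0"
    using h by (simp add: nn_integral_0_iff_AE)
  then have "AE w in M. h w = 0"
    by (subst AE_restrict_space_iff) auto
  then show ?thesis
    using AE_space
  proof eventually_elim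
    case (elim w)
    then obtain x t where w: "w = (x, t)" "t \<in> {0..T}" "x \<in> \<Omega>" by (auto simp: space_M)
    show ?case
    proof (cases "\<rho> t x \<ge> 0")
      case False
      then have "m w = 0" using elim(1) w by (simp add: h_def weight_eq del: atLeastAtMost_iff)
      moreover have "(\<lambda>\<theta>. indicator P ((\<theta>, x \<bullet> \<theta>), t) :: ennreal) \<in> borel_measurable borel" by measurable
      ultimately have "(\<integral>\<^sup>+ \<theta>. indicator P ((\<theta>, x \<bullet> \<theta>), t) \<partial>\<eta> t) = 0"
        using w nn_integral_eta_extension[OF _ w(2)] by (simp add: m_def)
      moreover have "(\<lambda>\<theta>. indicator P ((\<theta>, x \<bullet> \<theta>), t) :: ennreal) \<in> borel_measurable (\<eta> t)"
        by (rule measurable_compose[OF measurable_id_radon[OF eta_radon[OF w(2)]]]) measurable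
      ultimately have "AE \<theta> in \<eta> t. indicator P ((\<theta>, x \<bullet> \<theta>), t) = (0 :: ennreal)"
        by (simp add: nn_integral_0_iff_AE)
      then have "AE \<theta> in \<eta> t. indicat_real (dual_directions (I t) x) \<theta> = 0"
        by eventually_elim (use w in \<open>auto simp: indicator_def mem_P dual_directions_eq split: if_splits\<close>)
      then have "(LINT \<theta>:dual_directions (I t) x|\<eta> t. g ((\<theta>, x \<bullet> \<theta>), t)) = 0" for g :: "_ \<Rightarrow> real"
        unfolding set_lebesgue_integral_def by (intro integral_eq_zero_AE) auto
      then show ?thesis using w by simp
    qed (use w in simp)
  qed
qed

sublocale kernels: transposed_kernels M N line_kernel direction_kernel "2 * R" "C\<^sub>\<rho> * C\<^sub>\<eta>"
proof
  fix y assume "y \<in> space N"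
  then obtain z t where y: "y = (z, t)" "t \<in> {0..T}" "z \<in> I t" by (auto simp: spacetime_params_def)
  show "sets (line_kernel y) = sets M" by (simp add: line_kernel_def)
  have "emeasure (line_kernel y) (space M) = (\<integral>\<^sup>+ w. 1 \<partial>line_kernel y)"
    by (simp add: line_kernel_def)
  also have "\<dots> = (\<integral>\<^sup>+ x. extend_M (\<lambda>_. 1) (x, t) * indicator \<Omega> x \<partial>line_measure (fst z) (snd z))"
    unfolding y by (rule nn_integral_line_kernel) (use y in auto)
  also have "\<dots> \<le> (\<integral>\<^sup>+ x. indicator \<Omega> x \<partial>line_measure (fst z) (snd z))"
    by (intro nn_integral_mono) (simp add: extend_M_def indicator_def)
  also have "\<dots> = emeasure (line_measure (fst z) (snd z)) \<Omega>" by simp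
  also have "\<dots> \<le> ennreal (2 * R)"
    using I_sub[OF y(2)] y(3) \<Omega>_sub pos by (intro emeasure_line_le) (auto simp: unit_cylinder_def)
  finally show "emeasure (line_kernel y) (space M) \<le> ennreal (2 * R)" .
next
  fix w assume "w \<in> space M"
  then obtain x t where w: "w = (x, t)" "t \<in> {0..T}" by (auto simp: space_M)
  show "sets (direction_kernel w) = sets N" by (simp add: direction_kernel_def)
  have "emeasure (direction_kernel w) (space N) = (\<integral>\<^sup>+ y. 1 \<partial>direction_kernel w)"
    by (simp add: direction_kernel_def)
  also have "\<dots> = ennreal \<bar>\<rho> t x\<bar> * (\<integral>\<^sup>+ \<theta>. extend_N (\<lambda>_. 1) ((\<theta>, x \<bullet> \<theta>), t) \<partial>time_extension T \<eta> t)"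
    unfolding w by (rule nn_integral_direction_kernel) (use w in auto)
  also have "\<dots> \<le> ennreal C\<^sub>\<rho> * (\<integral>\<^sup>+ \<theta>. 1 \<partial>time_extension T \<eta> t)"
    using rho_bound[OF w(2)]
    by (intro mult_mono nn_integral_mono ennreal_leI) (auto simp: extend_N_def)
  also have "\<dots> \<le> ennreal C\<^sub>\<rho> * ennreal C\<^sub>\<eta>"
    using eta_extension_bound[of t] by (intro mult_left_mono) auto
  also have "\<dots> = ennreal (C\<^sub>\<rho> * C\<^sub>\<eta>)" using pos by (simp add: ennreal_mult)
  finally show "emeasure (direction_kernel w) (space N) \<le> ennreal (C\<^sub>\<rho> * C\<^sub>\<eta>)" .
next
  fix f :: "(real^2) \<times> real \<Rightarrow> ennreal" assume f: "f \<in> borel_measurable M"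
  have "(\<lambda>y. \<integral>\<^sup>+ x. extend_M f (x, snd y) * indicator \<Omega> x \<partial>line_measure (fst (fst y)) (snd (fst y)))
      \<in> borel_measurable N"
    unfolding measurable_N
    by (rule measurable_restrict_space1[OF measurable_nn_integral_lines[OF measurable_extend_M[OF f]]])
  then show "(\<lambda>y. \<integral>\<^sup>+ w. f w \<partial>line_kernel y) \<in> borel_measurable N"
    by (rule measurable_cong[THEN iffD1, rotated])
      (auto simp: spacetime_params_def nn_integral_line_kernel[OF f])
next
  fix g :: "((real^2) \<times> real) \<times> real \<Rightarrow> ennreal" assume g: "g \<in> borel_measurable N"
  note [measurable] = measurable_nn_integral_directions[OF measurable_extend_N[OF g]]
  have "(\<lambda>w. ennreal \<bar>weight w\<bar> *
      (\<integral>\<^sup>+ \<theta>. extend_N g ((\<theta>, fst w \<bullet> \<theta>), snd w) \<partial>time_extension T \<eta> (snd w))) \<in> borel_measurable M"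
    unfolding measurable_M by (intro measurable_restrict_space1) measurable
  then show "(\<lambda>w. \<integral>\<^sup>+ y. g y \<partial>direction_kernel w) \<in> borel_measurable M"
    by (rule measurable_cong[THEN iffD1, rotated])
      (auto simp: space_M weight_eq nn_integral_direction_kernel[OF g])
qed (use pos transpose_kernels in auto)

lemma measurable_dynamic_radon:
  assumes f: "f \<in> borel_measurable M"
  shows "dynamic_radon \<Omega> f \<in> borel_measurable N"
proof -
  note [measurable] = measurable_extend_M[OF f]
  have "(\<lambda>y. \<integral>r. indicat_real \<Omega> (snd (fst y) *\<^sub>R fst (fst y) + r *\<^sub>R rotate_right_angle (fst (fst y)))
      * extend_M f (snd (fst y) *\<^sub>R fst (fst y) + r *\<^sub>R rotate_right_angle (fst (fst y)), snd y) \<partial>lborel)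
    \<in> borel_measurable N" (is "?h \<in> _")
    unfolding measurable_N by (rule measurable_restrict_space1) measurable
  moreover have "?h y = dynamic_radon \<Omega> f y" if y: "y \<in> space N" for y
  proof -
    obtain \<theta> s t where y': "y = ((\<theta>, s), t)" "t \<in> {0..T}"
      using y by (auto simp: spacetime_params_def)
    have "dynamic_radon \<Omega> f y = (\<integral>x. indicat_real \<Omega> x * extend_M f (x, t) \<partial>line_measure \<theta> s)"
      unfolding y' dynamic_radon_def radon_transform_def set_lebesgue_integral_def prod.case
      using y' by (intro Bochner_Integration.integral_cong) (auto simp: extend_M_def indicator_def)
    also have "\<dots> = ?h y"
      unfolding y' line_measure_eq by (subst integral_distr) auto
    finally show ?thesis by simp
  qed
  ultimately show ?thesis by (rule measurable_cong[THEN iffD1, rotated])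
qed

lemma dynamic_radon_eq_kernel:
  assumes f: "f \<in> borel_measurable M" and y: "y \<in> space N"
  shows "dynamic_radon \<Omega> f y = (\<integral>w. f w \<partial>line_kernel y)"
  using y by (auto simp: spacetime_params_def integral_line_kernel(1)[OF f] dynamic_radon_def
      radon_transform_def)

lemma measurable_dynamic_radon_dual:
  assumes g: "g \<in> borel_measurable N"
  shows "dynamic_radon_dual I \<eta> \<rho> g \<in> borel_measurable M"
proof -
  note gm = measurable_extend_N[OF g]
  have [measurable]: "(\<lambda>w. \<integral>\<theta>. extend_N g ((\<theta>, fst w \<bullet> \<theta>), snd w) \<partial>time_extension T \<eta> (snd w))
      \<in> borel_measurable borel"
    using eta_kernel.measurable_integral[OF measurable_compose[OF measurable_direction_map gm]] by simp
  have "(\<lambda>w. weight w * (\<integral>\<theta>. extend_N g ((\<theta>, fst w \<bullet> \<theta>), snd w) \<partial>time_extension T \<eta> (snd w)))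
      \<in> borel_measurable M" (is "?h \<in> _")
    unfolding measurable_M by (rule measurable_restrict_space1) measurable
  moreover have "?h w = dynamic_radon_dual I \<eta> \<rho> g w" if w: "w \<in> space M" for w
  proof -
    obtain x t where w': "w = (x, t)" "t \<in> {0..T}" using w by (auto simp: space_M)
    have "(\<integral>\<theta>. extend_N g ((\<theta>, x \<bullet> \<theta>), t) \<partial>time_extension T \<eta> t)
        = (\<integral>\<theta>. extend_N g ((\<theta>, x \<bullet> \<theta>), t) \<partial>distr (\<eta> t) borel (\<lambda>\<theta>. \<theta>))"
      using w' by (simp add: time_extension_def)
    also have "\<dots> = (\<integral>\<theta>. extend_N g ((\<theta>, x \<bullet> \<theta>), t) \<partial>\<eta> t)"
    proof (rule integral_distr[OF measurable_id_radon[OF eta_radon[OF w'(2)]]])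
      show "(\<lambda>\<theta>. extend_N g ((\<theta>, x \<bullet> \<theta>), t)) \<in> borel_measurable borel"
        using gm by measurable
    qed
    also have "\<dots> = (LINT \<theta>:dual_directions (I t) x|\<eta> t. g ((\<theta>, x \<bullet> \<theta>), t))"
      unfolding set_lebesgue_integral_def using w'(2)
      by (intro Bochner_Integration.integral_cong) (auto simp: extend_N_def mem_P dual_directions_eq indicator_def)
    finally show ?thesis
      using w' by (simp add: dynamic_radon_dual_def radon_dual_def weight_eq del: atLeastAtMost_iff)
  qed
  ultimately show ?thesis by (rule measurable_cong[THEN iffD1, rotated])
qed

text \<open>
  The dual operator has the factor \<open>\<rho>\<close>, the kernel has \<open>\<bar>\<rho>\<bar>\<close>. At almost every point
  where these differ, the remaining integral over directions is zero.
\<close>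

lemma dynamic_radon_dual_eq_kernel:
  assumes g: "g \<in> borel_measurable N"
  shows "AE w in M. dynamic_radon_dual I \<eta> \<rho> g w = (\<integral>y. g y \<partial>direction_kernel w)"
  using AE_direction_kernel_zero AE_space
proof eventually_elim
  case (elim w)
  then obtain x t where w: "w = (x, t)" "t \<in> {0..T}" by (auto simp: space_M)
  show ?case
    using elim(1) unfolding w integral_direction_kernel(1)[OF g w(2)]
    by (auto simp: dynamic_radon_dual_def radon_dual_def)
qed

end

theorem proposition2p2:
  fixes T :: real
    and \<Omega> :: "(real^2) set"
    and I :: "real \<Rightarrow> ((real^2) \<times> real) set"
    and \<sigma> :: "real \<Rightarrow> ((real^2) \<times> real) measure"
    and \<eta> :: "real \<Rightarrow> (real^2) measure"
    and \<rho> :: "real \<Rightarrow> real^2 \<Rightarrow> real"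
    and p q :: ennreal
  assumes "T > 0"
    and "open \<Omega>" "connected \<Omega>" "\<Omega> \<noteq> {}" "bounded \<Omega>"
    and I_sub: "\<And>t. t \<in> {0..T} \<Longrightarrow> I t \<subseteq> unit_cylinder"
    and I_meas: "spacetime_params T I \<in> sets borel"
    and sigma_radon: "\<And>t. t \<in> {0..T} \<Longrightarrow> radon_measure_on (I t) (\<sigma> t)"
    and sigma_meas: "measurable_measure_family T I \<sigma>"
    and eta_radon: "\<And>t. t \<in> {0..T} \<Longrightarrow> radon_measure_on (directions (I t)) (\<eta> t)"
    and eta_meas: "measurable_measure_family T (\<lambda>t. directions (I t)) \<eta>"
    and eta_bounded: "\<exists>C::real. \<forall>t\<in>{0..T}. emeasure (\<eta> t) (directions (I t)) \<le> ennreal C"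
    and rho_meas: "(\<lambda>(x, t). \<rho> t x) \<in> borel_measurable (restrict_space borel (\<Omega> \<times> {0..T}))"
    and rho_bounded: "\<exists>C. \<forall>t\<in>{0..T}. \<forall>x\<in>\<Omega>. \<bar>\<rho> t x\<bar> \<le> C"
    and rho_supp: "\<And>t x. t \<in> {0..T} \<Longrightarrow> x \<notin> seen_region \<Omega> (I t) \<Longrightarrow> \<rho> t x = 0"
    and change: "\<And>t. t \<in> {0..T} \<Longrightarrow> change_of_variables \<Omega> (\<sigma> t) (\<eta> t) (\<rho> t)"
    and p: "1 \<le> p" "p < \<infinity>"
    and q: "conjugate_exponents p q"
  shows "max_chord \<Omega> < \<infinity> \<and>
    (let M = restrict_space lborel (\<Omega> \<times> {0..T}); N = spacetime_measure T I \<sigma> in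
      (\<forall>u\<in>Lp p M. AE ((\<theta>, s), t) in N. set_integrable (line_measure \<theta> s) \<Omega> (\<lambda>x. u (x, t))) \<and>
      Lp_operator p M N (dynamic_radon \<Omega>) \<and>
      (\<forall>\<phi>\<in>Lp q N. AE (x, t) in M. \<rho> t x = 0 \<or>
         set_integrable (\<eta> t) (dual_directions (I t) x) (\<lambda>\<theta>. \<phi> ((\<theta>, x \<bullet> \<theta>), t))) \<and>
      Lp_dual_operator p q M N (dynamic_radon \<Omega>) (dynamic_radon_dual I \<eta> \<rho>))"
proof -
  obtain R where "R > 0" and "\<forall>x\<in>\<Omega>. norm x \<le> R"
    using \<open>bounded \<Omega>\<close> bounded_pos by blast
  then have R: "R > 0" "\<Omega> \<subseteq> cball 0 R" by auto
  obtain C1 where C1: "\<And>t. t \<in> {0..T} \<Longrightarrow> emeasure (\<eta> t) (directions (I t)) \<le> ennreal C1"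
    using eta_bounded by blast
  obtain C2 where C2: "\<And>t x. t \<in> {0..T} \<Longrightarrow> x \<in> \<Omega> \<Longrightarrow> \<bar>\<rho> t x\<bar> \<le> C2"
    using rho_bounded by blast
  have outside: "\<rho> t x = 0" if "t \<in> {0..T}" "x \<notin> \<Omega>" for t x
    using rho_supp[of t x] that by (auto simp: seen_region_def)
  interpret dynamic_radon_data T I \<sigma> \<Omega> \<eta> \<rho> R "max 1 C2" "max 1 C1"
  proof
    show "emeasure (\<eta> t) (directions (I t)) \<le> ennreal (max 1 C1)" if "t \<in> {0..T}" for t
      using C1[OF that] by (rule order_trans) (simp add: ennreal_leI)
    show "\<bar>\<rho> t x\<bar> \<le> max 1 C2" if "t \<in> {0..T}" for t x
      using C2[OF that, of x] outside[OF that, of x] by (cases "x \<in> \<Omega>") auto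
  qed (use assms R outside in auto)
  have "max_chord \<Omega> \<le> ennreal (2 * R)"
    unfolding max_chord_def using R \<Omega>_borel
    by (intro SUP_least) (auto simp: unit_cylinder_def intro!: emeasure_line_le)
  then have chord: "max_chord \<Omega> < \<infinity>"
    by (rule order_le_less_trans) simp
  have lines: "AE ((\<theta>, s), t) in N. set_integrable (line_measure \<theta> s) \<Omega> (\<lambda>x. u (x, t))"
    if u: "u \<in> Lp p M" for u
  proof -
    have um: "u \<in> borel_measurable M" using u by (simp add: Lp_def)
    show ?thesis
      using kernels.AE_integrable_kernel[OF u p(1)] AE_space
    proof eventually_elim
      case (elim y)
      then obtain \<theta> s t where y: "y = ((\<theta>, s), t)" "t \<in> {0..T}" by (auto simp: spacetime_params_def)
      then show ?case using elim(1) integral_line_kernel(2)[OF um y(2), of "(\<theta>, s)"] by simp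
    qed
  qed
  have q1: "1 \<le> q" using q by (simp add: conjugate_exponents_def)
  interpret swapped: transposed_kernels N M direction_kernel line_kernel "max 1 C2 * max 1 C1" "2 * R"
    by (rule kernels.swap)
  have directions: "AE (x, t) in M. \<rho> t x = 0 \<or>
      set_integrable (\<eta> t) (dual_directions (I t) x) (\<lambda>\<theta>. \<phi> ((\<theta>, x \<bullet> \<theta>), t))"
    if \<phi>: "\<phi> \<in> Lp q N" for \<phi>
  proof -
    have \<phi>m: "\<phi> \<in> borel_measurable N" using \<phi> by (simp add: Lp_def)
    show ?thesis
      using swapped.AE_integrable_kernel[OF \<phi> q1] AE_space
    proof eventually_elim
      case (elim w)
      then obtain x t where w: "w = (x, t)" "t \<in> {0..T}" by (auto simp: space_M)
      then show ?case using elim(1) integral_direction_kernel(2)[OF \<phi>m w(2), of x] by auto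
    qed
  qed
  have forward: "AE y in N. dynamic_radon \<Omega> f y = (\<integral>w. f w \<partial>line_kernel y)" if "f \<in> borel_measurable M" for f
    by (rule AE_I2) (rule dynamic_radon_eq_kernel[OF that])
  have "Lp_operator p M N (dynamic_radon \<Omega>)"
    by (rule kernels.Lp_operator_kernel[OF p(1) measurable_dynamic_radon forward])
  moreover have "Lp_dual_operator p q M N (dynamic_radon \<Omega>) (dynamic_radon_dual I \<eta> \<rho>)"
    by (rule kernels.Lp_dual_operator_kernel[OF q p(2) measurable_dynamic_radon forward
          measurable_dynamic_radon_dual dynamic_radon_dual_eq_kernel])
  ultimately show ?thesis
    unfolding Let_def using chord lines directions by blast
qed

end
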